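(* Let $1\le k\le n$, $p=q>1$, $\varepsilon>0$, let $\varphi$ be a positive smooth function on $\mathbb{S}^n$, and let $u\in C^2(\mathbb{S}^n)$ (smooth enough for the equation to be differentiated) be a positive admissible solution of $$\sigma_k(\nabla^2u+uI)=u^{p-1+\varepsilon}(u^2+|\nabla u|^2)^{\frac{k+1-p}{2}}\varphi(x)\quad\text{on }\mathbb{S}^n.$$ Then there is a positive constant $C$ depending only on $n$, $k$, $\min_{\mathbb{S}^n}\varphi$ and $\|\varphi\|_{C^1}$, and independent of $\varepsilon$, such that $$\frac{|\nabla u(x)|}{u(x)}\le C\quad\text{for all }x\in\mathbb{S}^n,\qquad\text{and}\qquad\frac{\max_{\mathbb{S}^n}u}{\min_{\mathbb{S}^n}u}\le C.$$
   Context: $\mathbb{S}^n$ is the round unit sphere, $\nabla^2u$ the covariant Hessian, $I$ the identity. $\sigma_k$ of a symmetric matrix is the $k$-th elementary symmetric polynomial of its eigenvalues. $\Gamma_k=\{\lambda\in\mathbb{R}^n:\sigma_i(\lambda)>0,\ 1\le i\le k\}$; $u$ is admissible if the eigenvalues of $\nabla^2u+uI$ lie in $\Gamma_k$ everywhere. *)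

theory Defs
  imports "HOL-Analysis.Analysis"
begin

text \<open>The round unit sphere S^n is realised as sphere 0 1 in real^'m, with CARD('m) = n+1.\<close>

fun Ck_on :: "nat \<Rightarrow> (real^('m::finite)) set \<Rightarrow> (real^'m \<Rightarrow> real) \<Rightarrow> bool" where
  "Ck_on 0 S f = continuous_on S f"
| "Ck_on (Suc k) S f = (\<exists>g :: real^'m \<Rightarrow> real^'m.
      (\<forall>x\<in>S. (f has_derivative (\<lambda>h. g x \<bullet> h)) (at x)) \<and>
      (\<forall>i. Ck_on k S (\<lambda>x. g x $ i)))"

definition smooth_on :: "(real^'m::finite) set \<Rightarrow> (real^'m \<Rightarrow> real) \<Rightarrow> bool" where
  "smooth_on S f \<longleftrightarrow> (\<forall>k. Ck_on k S f)"

definition diag_mat :: "real^'n \<Rightarrow> real^'n^'n" where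
  "diag_mat l = (\<chi> i j. if i = j then l $ i else 0)"

definition sym_eigs :: "real^'n^'n \<Rightarrow> real^'n \<Rightarrow> bool" where
  "sym_eigs M l \<longleftrightarrow> (\<exists>Q. orthogonal_matrix Q \<and> M = Q ** diag_mat l ** transpose Q)"

definition eigvals :: "real^'n^'n \<Rightarrow> real^'n" where
  "eigvals M = (SOME l. sym_eigs M l)"

definition esym :: "nat \<Rightarrow> real^('n::finite) \<Rightarrow> real" where
  "esym k l = (\<Sum>S\<in>{S::'n set. card S = k}. \<Prod>i\<in>S. l $ i)"

definition sigma :: "nat \<Rightarrow> real^('n::finite)^'n \<Rightarrow> real" where
  "sigma k M = esym k (eigvals M)"

definition Gamma :: "nat \<Rightarrow> (real^('n::finite)) set" where
  "Gamma k = {l. \<forall>i. 1 \<le> i \<and> i \<le> k \<longrightarrow> esym i l > 0}"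

text \<open>Tangential projection at x on the sphere, spherical gradient and the matrix of
  the covariant Hessian plus u I on the tangent space (extended by 0 in the normal direction),
  computed from an ambient extension u with gradient g and Hessian H (Gauss formula).\<close>
definition tproj :: "real^'m \<Rightarrow> real^'m^'m" where
  "tproj x = mat 1 - (\<chi> i j. x $ i * x $ j)"

definition sgrad :: "(real^'m \<Rightarrow> real^'m) \<Rightarrow> real^'m \<Rightarrow> real^'m" where
  "sgrad g x = g x - (g x \<bullet> x) *\<^sub>R x"

definition hess_plus :: "(real^'m \<Rightarrow> real) \<Rightarrow> (real^'m \<Rightarrow> real^'m) \<Rightarrow> (real^'m \<Rightarrow> real^'m^'m)
    \<Rightarrow> real^'m \<Rightarrow> real^'m^'m" where
  "hess_plus u g H x = tproj x ** H x ** tproj x + (u x - g x \<bullet> x) *\<^sub>R tproj x"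

definition C1norm_sphere :: "(real^'m \<Rightarrow> real) \<Rightarrow> (real^'m \<Rightarrow> real^'m) \<Rightarrow> real" where
  "C1norm_sphere f gf = (SUP x\<in>sphere 0 1. \<bar>f x\<bar>) + (SUP x\<in>sphere 0 1. norm (sgrad gf x))"

end

(*
  Let G be the gradient and W the Hessian, on the sphere, of the one-homogeneous extension of u, so
  that W = \<nabla>\<^sup>2 u + u I and |G|^2 = u^2 + |\<nabla> u|^2.

  At a maximum of u, W \<le> u I gives an upper bound of u^\<epsilon> by a constant over min \<phi>; hence everywhere
  sigma_k(W / u) \<le> D M^(k/2), where M is the maximum of |G|^2 / u^2.  At a point where M is attained,
  \<nabla> u is an eigenvector of W with eigenvalue M u.  Summing the second order condition along great
  circles against the derivatives F_i = \<partial>sigma_k / \<partial>\<lambda>_i and using the differentiated equation, one gets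
    sum over i \<noteq> 1 of F_i ((\<lambda>_i / u - 1)^2 + t^2) \<le> c t sigma_k   with t^2 = M - 1,
  which bounds the derivative of sigma_k in the positive direction (1 + t^2, t, ..., t) by a multiple of
  sigma_k.  By concavity (Garding's inequality) sigma_k at (1 + t^2, t, ..., t), which is at least
  t^(k+1), is then at most a constant times sigma_k \<le> D' t^k, so that t is bounded.  The ratio
  max u / min u is controlled by integrating the gradient bound along great circles.
*)
theory Submission
  imports Defs
begin

section \<open>Elementary symmetric functions and their positivity cones\<close>

text \<open>\<open>eigvals\<close> merely chooses some vector of eigenvalues, so sigma_k is
  differentiated in another form, polynomial in the matrix entries: as a sum of principal minors, a
  coefficient of det (1 + t A). The matrices act on the ambient space of dimension n + 1, and the
  normal x lies in the kernel of W. This additional eigenvalue 0 changes no elementary symmetric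
  function and is dropped by removing an index; partial derivatives remove an index too, which is
  why \<open>elsym\<close> carries its index set. The constant is free of \<epsilon> for two
  reasons. The total degree (p - 1 + \<epsilon>) + (k + 1 - p) = k + \<epsilon> of the right side in
  u and G is at least the degree k of sigma_k, so that the zeroth order term has a good sign; and
  after division by u^k the size of u survives only as u^\<epsilon>, bounded at the maximum of u.
  The condition p > 1 enters in replacing M^((k+1-p)/2) by M^(k/2). Concavity is obtained from the
  quotients sigma_(j+1) / sigma_j: these are superadditive on the cone, and sigma_k is their
  product.\<close>

definition elsym :: "nat \<Rightarrow> 'a set \<Rightarrow> ('a \<Rightarrow> real) \<Rightarrow> real" where
  "elsym k I w = (\<Sum>S | S \<subseteq> I \<and> card S = k. \<Prod>i\<in>S. w i)"

lemma elsym_0 [simp]: "finite I \<Longrightarrow> elsym 0 I w = 1"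
proof -
  assume "finite I"
  then have "{S. S \<subseteq> I \<and> card S = 0} = {{}}"
    by (auto dest: finite_subset)
  then show ?thesis
    by (simp only: elsym_def) simp
qed

lemma elsym_Suc_empty [simp]: "elsym (Suc k) {} w = 0"
  by (simp add: elsym_def cong: conj_cong)

lemma elsym_cong: "(\<And>i. i \<in> I \<Longrightarrow> w i = v i) \<Longrightarrow> elsym k I w = elsym k I v"
  unfolding elsym_def by (rule sum.cong) (auto intro!: prod.cong)

lemma elsym_insert:
  assumes "finite I" "a \<notin> I"
  shows "elsym (Suc k) (insert a I) w = w a * elsym k I w + elsym (Suc k) I w"
proof -
  let ?A = "{S. S \<subseteq> I \<and> card S = k}" and ?B = "{S. S \<subseteq> I \<and> card S = Suc k}"
  have fin: "finite S" if "S \<subseteq> I" for S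
    using assms(1) that by (rule rev_finite_subset)
  have eq: "{S. S \<subseteq> insert a I \<and> card S = Suc k} = insert a ` ?A \<union> ?B" (is "?L = ?R")
  proof
    show "?L \<subseteq> ?R"
    proof
      fix S assume S: "S \<in> ?L"
      show "S \<in> ?R"
      proof (cases "a \<in> S")
        case True
        then have "S = insert a (S - {a})" "S - {a} \<subseteq> I" "card (S - {a}) = k"
          using S by auto
        then show ?thesis by blast
      qed (use S in auto)
    qed
    show "?R \<subseteq> ?L"
      using assms fin by (auto simp: card_insert_if)
  qed
  have inj: "inj_on (insert a) ?A"
    using assms(2) by (auto simp: inj_on_def)
  have "elsym (Suc k) (insert a I) w = (\<Sum>S\<in>insert a ` ?A. \<Prod>i\<in>S. w i) + (\<Sum>S\<in>?B. \<Prod>i\<in>S. w i)"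
    unfolding elsym_def eq using assms by (intro sum.union_disjoint) auto
  also have "(\<Sum>S\<in>insert a ` ?A. \<Prod>i\<in>S. w i) = (\<Sum>S\<in>?A. w a * (\<Prod>i\<in>S. w i))"
    unfolding sum.reindex[OF inj] o_def
    using assms fin by (intro sum.cong refl prod.insert) auto
  finally show ?thesis
    by (simp add: elsym_def sum_distrib_left)
qed

lemma elsym_remove:
  assumes "finite I" "a \<in> I"
  shows "elsym (Suc k) I w = w a * elsym k (I - {a}) w + elsym (Suc k) (I - {a}) w"
  using elsym_insert[of "I - {a}" a k w] assms by (simp add: insert_absorb)

lemma elsym_1: "finite I \<Longrightarrow> elsym (Suc 0) I w = sum w I"
  by (induction I rule: finite_induct) (auto simp: elsym_insert)

lemma elsym_scale:
  "elsym k I (\<lambda>i. c * w i) = c ^ k * elsym k I w"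
  unfolding elsym_def sum_distrib_left
  by (rule sum.cong) (auto simp: prod.distrib)

lemma elsym_ge_prod:
  assumes "finite I" "S \<subseteq> I" "\<And>i. i \<in> I \<Longrightarrow> 0 \<le> w i"
  shows "(\<Prod>i\<in>S. w i) \<le> elsym (card S) I w"
  unfolding elsym_def using assms
  by (intro member_le_sum[of S _ "\<lambda>S. \<Prod>i\<in>S. w i"]) (auto intro!: prod_nonneg)

lemma elsym_pos:
  assumes "finite I" "k \<le> card I" "\<And>i. i \<in> I \<Longrightarrow> 0 < w i"
  shows "0 < elsym k I w"
proof -
  obtain S where S: "S \<subseteq> I" "card S = k"
    using obtain_subset_with_card_n[OF assms(2)] by metis
  have "0 < (\<Prod>i\<in>S. w i)"
    using S assms by (intro prod_pos) auto
  also have "\<dots> \<le> elsym k I w"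
    using elsym_ge_prod[OF assms(1) S(1), of w] assms(3) S by (auto intro: less_imp_le)
  finally show ?thesis .
qed

lemma elsym_abs_le:
  assumes "finite I" "0 \<le> B" "\<And>i. i \<in> I \<Longrightarrow> \<bar>w i\<bar> \<le> B"
  shows "\<bar>elsym k I w\<bar> \<le> 2 ^ card I * B ^ k"
proof -
  have "\<bar>elsym k I w\<bar> \<le> (\<Sum>S | S \<subseteq> I \<and> card S = k. B ^ k)"
    unfolding elsym_def
  proof (rule order_trans[OF sum_abs sum_mono])
    fix S assume "S \<in> {S. S \<subseteq> I \<and> card S = k}"
    then have "\<bar>prod w S\<bar> \<le> (\<Prod>i\<in>S. B)" "card S = k"
      unfolding abs_prod using assms by (intro prod_mono, auto)
    then show "\<bar>prod w S\<bar> \<le> B ^ k" by simp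
  qed
  also have "\<dots> \<le> real (card (Pow I)) * B ^ k"
    unfolding sum_constant using assms(1,2)
    by (intro mult_right_mono) (auto intro!: card_mono)
  finally show ?thesis
    using assms(1) by (simp add: card_Pow)
qed

text \<open>Each (k+1)-subset of \<open>I\<close> is counted once for every one of its elements.
  This is Euler's identity for homogeneous polynomials, as \<open>elsym k (I - {i})\<close> is the
  partial derivative in the variable \<open>i\<close>.\<close>

lemma elsym_euler:
  assumes "finite I"
  shows "(\<Sum>i\<in>I. w i * elsym k (I - {i}) w) = real (Suc k) * elsym (Suc k) I w"
  using assms
proof (induction I arbitrary: k rule: finite_induct)
  case empty
  then show ?case by simp
next
  case (insert a I)
  have rm: "insert a I - {i} = insert a (I - {i})" if "i \<in> I" for i
    using insert.hyps that by auto
  have "(\<Sum>i\<in>insert a I. w i * elsym k (insert a I - {i}) w)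
      = w a * elsym k I w + (\<Sum>i\<in>I. w i * elsym k (insert a (I - {i})) w)"
    using insert.hyps by (auto simp: rm intro!: sum.cong)
  also have "(\<Sum>i\<in>I. w i * elsym k (insert a (I - {i})) w)
      = real k * w a * elsym k I w + real (Suc k) * elsym (Suc k) I w"
  proof (cases k)
    case 0
    then show ?thesis using insert.hyps by (simp add: elsym_1)
  next
    case (Suc j)
    have "(\<Sum>i\<in>I. w i * elsym k (insert a (I - {i})) w)
        = w a * (\<Sum>i\<in>I. w i * elsym j (I - {i}) w) + (\<Sum>i\<in>I. w i * elsym k (I - {i}) w)"
      using insert.hyps unfolding Suc
      by (simp add: elsym_insert sum_distrib_left sum.distrib algebra_simps)
    then show ?thesis
      unfolding insert.IH by (simp add: Suc)
  qed
  finally show ?case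
    using insert.hyps by (simp add: elsym_insert algebra_simps)
qed

text \<open>\<open>elsym\<close> is affine in each variable, and the coefficient of the variable
  \<open>i\<close> is the function of order one less in the others.\<close>

lemma has_real_derivative_elsym:
  assumes "finite I" "\<And>i. i \<in> I \<Longrightarrow> ((\<lambda>s. w s i) has_real_derivative x i) (at s)"
  shows "((\<lambda>s. elsym (Suc k) I (w s)) has_real_derivative
    (\<Sum>i\<in>I. x i * elsym k (I - {i}) (w s))) (at s)"
  using assms
proof (induction I arbitrary: k rule: finite_induct)
  case empty
  then show ?case by simp
next
  case (insert a I)
  have rm: "insert a I - {i} = insert a (I - {i})" if "i \<in> I" for i
    using insert.hyps that by auto
  have IH: "((\<lambda>s. elsym (Suc k) I (w s)) has_real_derivative
    (\<Sum>i\<in>I. x i * elsym k (I - {i}) (w s))) (at s)" for k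
    using insert by simp
  have da: "((\<lambda>s. w s a) has_real_derivative x a) (at s)"
    using insert by simp
  show ?case
  proof (cases k)
    case 0
    have "((\<lambda>s. sum (w s) (insert a I)) has_real_derivative sum x (insert a I)) (at s)"
      using insert.prems by (intro DERIV_sum) auto
    then show ?thesis
      unfolding 0 using insert.hyps by (simp add: elsym_1)
  next
    case (Suc j)
    have "((\<lambda>s. w s a * elsym (Suc j) I (w s) + elsym (Suc (Suc j)) I (w s)) has_real_derivative
       (x a * elsym (Suc j) I (w s) + (\<Sum>i\<in>I. x i * elsym j (I - {i}) (w s)) * w s a)
       + (\<Sum>i\<in>I. x i * elsym (Suc j) (I - {i}) (w s))) (at s)"
      by (intro DERIV_add DERIV_mult da IH)
    also have "(\<lambda>s. w s a * elsym (Suc j) I (w s) + elsym (Suc (Suc j)) I (w s))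
       = (\<lambda>s. elsym (Suc k) (insert a I) (w s))"
      using insert.hyps by (simp add: elsym_insert Suc)
    also have "(x a * elsym (Suc j) I (w s) + (\<Sum>i\<in>I. x i * elsym j (I - {i}) (w s)) * w s a)
       + (\<Sum>i\<in>I. x i * elsym (Suc j) (I - {i}) (w s))
       = x a * elsym (Suc j) I (w s) + (\<Sum>i\<in>I. x i * elsym (Suc j) (insert a (I - {i})) (w s))"
      using insert.hyps
      by (simp add: elsym_insert sum_distrib_left sum_distrib_right sum.distrib algebra_simps)
    also have "\<dots> = (\<Sum>i\<in>insert a I. x i * elsym k (insert a I - {i}) (w s))"
      unfolding Suc using insert.hyps by (auto simp: rm intro!: sum.cong)
    finally show ?thesis .
  qed
qed

section \<open>Positivity cones: removal of a variable and concavity of the ratios\<close>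

definition pos_cone :: "nat \<Rightarrow> 'a set \<Rightarrow> ('a \<Rightarrow> real) \<Rightarrow> bool" where
  "pos_cone k I w \<longleftrightarrow> (\<forall>j\<le>k. 0 < elsym j I w)"

lemma pos_cone_0 [simp]: "finite I \<Longrightarrow> pos_cone 0 I w"
  by (simp add: pos_cone_def)

lemma pos_cone_Suc: "pos_cone (Suc k) I w \<longleftrightarrow> pos_cone k I w \<and> 0 < elsym (Suc k) I w"
  by (auto simp: pos_cone_def le_Suc_eq)

lemma pos_cone_mono: "pos_cone k I w \<Longrightarrow> j \<le> k \<Longrightarrow> pos_cone j I w"
  by (auto simp: pos_cone_def)

text \<open>The ratios are homogeneous of degree one and superadditive on the cone, unlike
  \<open>elsym\<close> of higher order. On \<open>pos_cone k\<close> the denominator is positive,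
  while the numerator can have either sign.\<close>

definition elsym_ratio :: "nat \<Rightarrow> 'a set \<Rightarrow> ('a \<Rightarrow> real) \<Rightarrow> real" where
  "elsym_ratio k I w = elsym (Suc k) I w / elsym k I w"

text \<open>Marcus--Lopes: by Euler's identity, the ratio of consecutive elementary symmetric functions is
  an average of the functions \<open>w i - (w i)\<^sup>2 / (w i + r)\<close> with \<open>r\<close> the preceding ratio on
  the remaining variables, and \<open>a\<^sup>2 / b\<close> is subadditive and decreasing in \<open>b\<close>.\<close>

lemma elsym_ratio_step:
  assumes "finite I" "0 < elsym (Suc k) I w" "\<And>i. i \<in> I \<Longrightarrow> 0 < elsym k (I - {i}) w"
  shows "real (k + 2) * elsym_ratio (Suc k) I w
      = (\<Sum>i\<in>I. w i - (w i)\<^sup>2 / (w i + elsym_ratio k (I - {i}) w))"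
    and "\<And>i. i \<in> I \<Longrightarrow> 0 < w i + elsym_ratio k (I - {i}) w"
proof -
  have z: "w i + elsym_ratio k (I - {i}) w = elsym (Suc k) I w / elsym k (I - {i}) w"
    if "i \<in> I" for i
    using assms(3)[OF that] by (simp add: elsym_ratio_def elsym_remove[OF assms(1) that] field_simps)
  then show "0 < w i + elsym_ratio k (I - {i}) w" if "i \<in> I" for i
    using that assms by simp
  have "real (k + 2) * elsym_ratio (Suc k) I w
      = (\<Sum>i\<in>I. w i * elsym (Suc k) (I - {i}) w / elsym (Suc k) I w)"
    using elsym_euler[OF assms(1), of w "Suc k"]
    by (simp add: elsym_ratio_def sum_divide_distrib[symmetric])
  also have "\<dots> = (\<Sum>i\<in>I. w i - (w i)\<^sup>2 / (w i + elsym_ratio k (I - {i}) w))"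
  proof (rule sum.cong)
    fix i assume i: "i \<in> I"
    have 1: "elsym (Suc k) (I - {i}) w = elsym (Suc k) I w - w i * elsym k (I - {i}) w"
      using elsym_remove[OF assms(1) i] by simp
    have "a * (E - a * F) / E = a - a\<^sup>2 / (E / F)" if "E > 0" "F > 0" for a E F :: real
      using that by (simp add: field_simps power2_eq_square)
    then show "w i * elsym (Suc k) (I - {i}) w / elsym (Suc k) I w
        = w i - (w i)\<^sup>2 / (w i + elsym_ratio k (I - {i}) w)"
      unfolding z[OF i] 1 using assms(2) assms(3)[OF i] by blast
  qed simp
  finally show "real (k + 2) * elsym_ratio (Suc k) I w
      = (\<Sum>i\<in>I. w i - (w i)\<^sup>2 / (w i + elsym_ratio k (I - {i}) w))" .
qed

text \<open>For z = x + y the difference of the two sides is (a y - b x)^2 / (x y (x + y)); a larger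
  z only lowers the left side.\<close>

lemma quotient_square_subadditive:
  fixes a b x y z :: real
  assumes "0 < x" "0 < y" "x + y \<le> z"
  shows "(a + b)\<^sup>2 / z \<le> a\<^sup>2 / x + b\<^sup>2 / y"
proof -
  have "(a + b)\<^sup>2 / z \<le> (a + b)\<^sup>2 / (x + y)"
    using assms by (intro divide_left_mono) auto
  also have "\<dots> \<le> a\<^sup>2 / x + b\<^sup>2 / y"
  proof -
    have "a\<^sup>2 / x + b\<^sup>2 / y - (a + b)\<^sup>2 / (x + y) = (a * y - b * x)\<^sup>2 / (x * y * (x + y))"
      using assms by (simp add: field_simps power2_eq_square)
    also have "\<dots> \<ge> 0" using assms by simp
    finally show ?thesis by simp
  qed
  finally show ?thesis .
qed

text \<open>This property and \<open>ratio_superadd\<close> are named because they are proved by a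
  simultaneous induction on k, each for all index sets: superadditivity at k + 1 uses both at k, and
  restriction at k + 1 uses restriction at k and superadditivity at k + 1. The \<open>itself\<close>
  argument records the element type, which occurs only in bound variables.\<close>

definition cone_restrict :: "nat \<Rightarrow> 'a itself \<Rightarrow> bool" where
  "cone_restrict k TYPE('a) \<longleftrightarrow> (\<forall>(I :: 'a set) w i.
     finite I \<longrightarrow> i \<in> I \<longrightarrow> pos_cone (Suc k) I w \<longrightarrow> pos_cone k (I - {i}) w)"

definition ratio_superadd :: "nat \<Rightarrow> 'a itself \<Rightarrow> bool" where
  "ratio_superadd k TYPE('a) \<longleftrightarrow> (\<forall>(I :: 'a set) w v.
     finite I \<longrightarrow> pos_cone k I w \<longrightarrow> pos_cone k I v \<longrightarrow>
     pos_cone k I (\<lambda>i. w i + v i) \<and>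
     elsym_ratio k I w + elsym_ratio k I v \<le> elsym_ratio k I (\<lambda>i. w i + v i))"

lemma ratio_superadd_0: "ratio_superadd 0 TYPE('a)"
  by (auto simp: ratio_superadd_def elsym_ratio_def elsym_1 sum.distrib)

lemma ratio_superadd_Suc:
  assumes R: "cone_restrict k TYPE('a)" and S: "ratio_superadd k TYPE('a)"
  shows "ratio_superadd (Suc k) TYPE('a)"
  unfolding ratio_superadd_def
proof (intro allI impI)
  fix I :: "'a set" and w v
  assume I: "finite I" and w: "pos_cone (Suc k) I w" and v: "pos_cone (Suc k) I v"
  let ?z = "\<lambda>i. w i + v i"
  have wk: "pos_cone k I w" and vk: "pos_cone k I v"
    using w v by (auto simp: pos_cone_Suc)
  have zk: "pos_cone k I ?z" and zr: "elsym_ratio k I w + elsym_ratio k I v \<le> elsym_ratio k I ?z"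
    using S I wk vk unfolding ratio_superadd_def by blast+
  \<comment> \<open>Closure of the next cone under addition: the ratio of order k at the sum
    dominates two positive ratios, so its numerator is positive.\<close>
  have "0 < elsym_ratio k I w" "0 < elsym_ratio k I v"
    using w v by (auto simp: elsym_ratio_def pos_cone_def)
  then have "0 < elsym_ratio k I ?z" using zr by linarith
  moreover have "0 < elsym k I ?z" using zk by (simp add: pos_cone_def)
  ultimately have "0 < elsym (Suc k) I ?z"
    by (simp add: elsym_ratio_def zero_less_divide_iff)
  then have z: "pos_cone (Suc k) I ?z" using zk by (simp add: pos_cone_Suc)
  have res: "pos_cone k (I - {i}) y" if "pos_cone (Suc k) I y" "i \<in> I" for y i
    using R I that unfolding cone_restrict_def by blast
  have step: "real (k + 2) * elsym_ratio (Suc k) I y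
        = (\<Sum>i\<in>I. y i - (y i)\<^sup>2 / (y i + elsym_ratio k (I - {i}) y))"
      "\<And>i. i \<in> I \<Longrightarrow> 0 < y i + elsym_ratio k (I - {i}) y"
    if "pos_cone (Suc k) I y" for y
  proof -
    have a: "0 < elsym (Suc k) I y" and b: "\<And>i. i \<in> I \<Longrightarrow> 0 < elsym k (I - {i}) y"
      using that res[OF that] by (auto simp: pos_cone_def)
    show "real (k + 2) * elsym_ratio (Suc k) I y
        = (\<Sum>i\<in>I. y i - (y i)\<^sup>2 / (y i + elsym_ratio k (I - {i}) y))"
      by (rule elsym_ratio_step(1)[OF I a b])
    show "0 < y i + elsym_ratio k (I - {i}) y" if "i \<in> I" for i
      by (rule elsym_ratio_step(2)[OF I a b that])
  qed
  have "real (k + 2) * elsym_ratio (Suc k) I w + real (k + 2) * elsym_ratio (Suc k) I v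
      \<le> real (k + 2) * elsym_ratio (Suc k) I ?z"
    unfolding step(1)[OF w] step(1)[OF v] step(1)[OF z] sum.distrib[symmetric]
  proof (rule sum_mono)
    fix i assume i: "i \<in> I"
    have "elsym_ratio k (I - {i}) w + elsym_ratio k (I - {i}) v \<le> elsym_ratio k (I - {i}) ?z"
      using S I res[OF w i] res[OF v i] unfolding ratio_superadd_def by blast
    then have "(w i + v i)\<^sup>2 / (?z i + elsym_ratio k (I - {i}) ?z)
        \<le> (w i)\<^sup>2 / (w i + elsym_ratio k (I - {i}) w) + (v i)\<^sup>2 / (v i + elsym_ratio k (I - {i}) v)"
      using step(2)[OF w i] step(2)[OF v i] by (intro quotient_square_subadditive) auto
    then show "w i - (w i)\<^sup>2 / (w i + elsym_ratio k (I - {i}) w) +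
        (v i - (v i)\<^sup>2 / (v i + elsym_ratio k (I - {i}) v))
        \<le> ?z i - (?z i)\<^sup>2 / (?z i + elsym_ratio k (I - {i}) ?z)"
      by simp
  qed
  then have "real (k + 2) * (elsym_ratio (Suc k) I w + elsym_ratio (Suc k) I v)
      \<le> real (k + 2) * elsym_ratio (Suc k) I ?z"
    by (simp only: distrib_left)
  then have "elsym_ratio (Suc k) I w + elsym_ratio (Suc k) I v \<le> elsym_ratio (Suc k) I ?z"
    by (rule mult_left_le_imp_le) simp
  then show "pos_cone (Suc k) I ?z \<and>
      elsym_ratio (Suc k) I w + elsym_ratio (Suc k) I v \<le> elsym_ratio (Suc k) I ?z"
    using z by blast
qed

text \<open>If \<open>elsym (k + 1)\<close> without the variable \<open>i\<close> were not positive, then the ratio, as a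
  function of the variable \<open>i\<close> alone, would be a strictly decreasing convex hyperbola, against
  superadditivity.\<close>

lemma cone_restrict_Suc:
  assumes R: "cone_restrict k TYPE('a)" and S: "ratio_superadd (Suc k) TYPE('a)"
  shows "cone_restrict (Suc k) TYPE('a)"
  unfolding cone_restrict_def
proof (intro allI impI)
  fix I :: "'a set" and w i
  assume I: "finite I" and i: "i \<in> I" and w: "pos_cone (Suc (Suc k)) I w"
  define J where "J = I - {i}"
  have J: "finite J" using I by (simp add: J_def)
  have wk: "pos_cone (Suc k) I w" using w by (simp add: pos_cone_Suc)
  have wJ: "pos_cone k J w" using R I i wk unfolding cone_restrict_def J_def by blast
  \<comment> \<open>Moving the variable \<open>i\<close> alone makes every \<open>elsym\<close>
    affine in the shift s, so that the ratio becomes (A + s B) / (C + s D).\<close>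
  define w' where "w' = (\<lambda>s. w(i := w i + s))"
  have upd: "elsym (Suc j) I (w' s) = elsym (Suc j) I w + s * elsym j J w" for j s
  proof -
    have "elsym l J (w' s) = elsym l J w" for l
      by (rule elsym_cong) (auto simp: J_def w'_def)
    then show ?thesis
      unfolding elsym_remove[OF I i, folded J_def] by (simp add: w'_def algebra_simps)
  qed
  have cone: "pos_cone (Suc k) I (w' s)" if "s \<ge> 0" for s
    unfolding pos_cone_def
  proof (intro allI impI)
    fix j assume j: "j \<le> Suc k"
    show "0 < elsym j I (w' s)"
    proof (cases j)
      case 0
      then show ?thesis using I by simp
    next
      case (Suc l)
      have "0 < elsym (Suc l) I w" "0 < elsym l J w"
        using wk wJ j Suc by (auto simp: pos_cone_def)
      then show ?thesis using that by (simp add: Suc upd add_pos_nonneg)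
    qed
  qed
  define A B C D where "A = elsym (Suc (Suc k)) I w" and "B = elsym (Suc k) J w"
    and "C = elsym (Suc k) I w" and "D = elsym k J w"
  have A: "A > 0" and C: "C > 0" and D: "D > 0"
    using w wJ by (auto simp: pos_cone_def A_def C_def D_def)
  have "B > 0"
  proof (rule ccontr)
    assume "\<not> B > 0"
    then have B: "B \<le> 0" by simp
    have rat: "elsym_ratio (Suc k) I (w' s) = (A + s * B) / (C + s * D)" for s
      by (simp add: elsym_ratio_def upd A_def B_def C_def D_def)
    \<comment> \<open>The shifts 0 and 2 add up to twice the shift 1; by homogeneity,
      superadditivity becomes concavity at the midpoint 1.\<close>
    have "elsym_ratio (Suc k) I (w' 0) + elsym_ratio (Suc k) I (w' 2)
        \<le> elsym_ratio (Suc k) I (\<lambda>j. w' 0 j + w' 2 j)"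
      using S I cone[of 0] cone[of 2] unfolding ratio_superadd_def by (meson order_refl zero_le_numeral)
    also have "(\<lambda>j. w' 0 j + w' 2 j) = (\<lambda>j. 2 * w' 1 j)"
      by (auto simp: w'_def)
    also have "elsym_ratio (Suc k) I (\<lambda>j. 2 * w' 1 j) = 2 * elsym_ratio (Suc k) I (w' 1)"
      by (simp add: elsym_ratio_def elsym_scale)
    finally have "A / C + (A + 2 * B) / (C + 2 * D) \<le> 2 * ((A + B) / (C + D))"
      by (simp add: rat)
    moreover have "A / C + (A + 2 * B) / (C + 2 * D) - 2 * ((A + B) / (C + D))
        = 2 * D * (A * D - B * C) / (C * (C + D) * (C + 2 * D))"
      using C D by (simp add: divide_simps) (simp add: algebra_simps)
    moreover have "A * D - B * C > 0"
      using A C D B by (smt (verit) mult_nonpos_nonneg mult_pos_pos)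
    then have "2 * D * (A * D - B * C) / (C * (C + D) * (C + 2 * D)) > 0"
      using C D by simp
    ultimately show False by linarith
  qed
  then show "pos_cone (Suc k) (I - {i}) w"
    using wJ by (simp add: pos_cone_Suc B_def J_def)
qed

lemma cone_restrict_ratio_superadd:
  "cone_restrict k TYPE('a) \<and> ratio_superadd k TYPE('a)"
proof (induction k)
  case 0
  show ?case
    by (auto simp: ratio_superadd_0) (simp add: cone_restrict_def)
next
  case (Suc k)
  then show ?case
    using ratio_superadd_Suc cone_restrict_Suc by blast
qed

lemma pos_cone_restrict:
  fixes I :: "'a set"
  shows "finite I \<Longrightarrow> i \<in> I \<Longrightarrow> pos_cone (Suc k) I w \<Longrightarrow> pos_cone k (I - {i}) w"
  using cone_restrict_ratio_superadd[of k, where 'a='a] unfolding cone_restrict_def by blast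

lemma pos_cone_add:
  fixes I :: "'a set"
  shows "finite I \<Longrightarrow> pos_cone k I w \<Longrightarrow> pos_cone k I v \<Longrightarrow> pos_cone k I (\<lambda>i. w i + v i)"
  using cone_restrict_ratio_superadd[of k, where 'a='a] unfolding ratio_superadd_def by blast

lemma elsym_ratio_superadd:
  fixes I :: "'a set"
  shows "finite I \<Longrightarrow> pos_cone k I w \<Longrightarrow> pos_cone k I v \<Longrightarrow>
    elsym_ratio k I w + elsym_ratio k I v \<le> elsym_ratio k I (\<lambda>i. w i + v i)"
  using cone_restrict_ratio_superadd[of k, where 'a='a] unfolding ratio_superadd_def by blast

text \<open>The product telescopes down to \<open>elsym 0\<close>, which is 1.\<close>

lemma elsym_eq_prod_ratio:
  "finite I \<Longrightarrow> pos_cone k I w \<Longrightarrow> elsym k I w = (\<Prod>j<k. elsym_ratio j I w)"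
proof (induction k)
  case (Suc k)
  have 1: "pos_cone k I w" and 2: "0 < elsym k I w"
    using Suc.prems(2) by (auto simp: pos_cone_def)
  have "(\<Prod>j<Suc k. elsym_ratio j I w) = elsym k I w * elsym_ratio k I w"
    using Suc.IH[OF Suc.prems(1) 1] by simp
  then show ?case using 2 by (simp add: elsym_ratio_def)
qed simp

lemma elsym_ratio_pos: "pos_cone k I w \<Longrightarrow> j < k \<Longrightarrow> 0 < elsym_ratio j I w"
  by (auto simp: pos_cone_def elsym_ratio_def)

text \<open>In the product of ratios, superadditivity is kept in full for the factor
  \<open>j\<close> alone; in the others the positive ratio of \<open>v\<close> is discarded. The
  result is linear in that single ratio of \<open>v\<close>, so its first order form bounds each
  ratio separately.\<close>

lemma elsym_add_ge:
  assumes I: "finite I" and w: "pos_cone k I w" and v: "pos_cone k I v" and j: "j < k"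
  shows "elsym k I w * (1 + elsym_ratio j I v / elsym_ratio j I w) \<le> elsym k I (\<lambda>i. w i + v i)"
proof -
  have rw: "elsym_ratio l I w > 0" and rv: "elsym_ratio l I v > 0" if "l < k" for l
    using that w v elsym_ratio_pos by blast+
  have "elsym k I w * (1 + elsym_ratio j I v / elsym_ratio j I w)
      = (\<Prod>l\<in>{..<k} - {j}. elsym_ratio l I w) * (elsym_ratio j I w + elsym_ratio j I v)"
    unfolding elsym_eq_prod_ratio[OF I w] using j rw[OF j]
    by (subst prod.remove[of _ j]) (auto simp: field_simps)
  also have "\<dots> \<le> (\<Prod>l\<in>{..<k} - {j}. elsym_ratio l I (\<lambda>i. w i + v i)) * elsym_ratio j I (\<lambda>i. w i + v i)"
  proof (intro mult_mono prod_mono conjI)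
    fix l assume l: "l \<in> {..<k} - {j}"
    have "elsym_ratio l I w + elsym_ratio l I v \<le> elsym_ratio l I (\<lambda>i. w i + v i)"
      using I w v l by (intro elsym_ratio_superadd) (auto intro: pos_cone_mono)
    then show "elsym_ratio l I w \<le> elsym_ratio l I (\<lambda>i. w i + v i)"
      using rv[of l] l by simp
    show "0 \<le> elsym_ratio l I w" using rw[of l] l by simp
  next
    show "elsym_ratio j I w + elsym_ratio j I v \<le> elsym_ratio j I (\<lambda>i. w i + v i)"
      using I w v j by (intro elsym_ratio_superadd) (auto intro: pos_cone_mono)
  next
    show "0 \<le> (\<Prod>l\<in>{..<k} - {j}. elsym_ratio l I (\<lambda>i. w i + v i))"
      using elsym_ratio_pos[OF pos_cone_add[OF I w v]] by (intro prod_nonneg) (auto intro: less_imp_le)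
  qed (use rw rv j in \<open>simp add: add_nonneg_nonneg less_imp_le\<close>)
  also have "\<dots> = elsym k I (\<lambda>i. w i + v i)"
    unfolding elsym_eq_prod_ratio[OF I pos_cone_add[OF I w v]] using j
    by (subst (2) prod.remove[of _ j]) auto
  finally show ?thesis .
qed

text \<open>A form of Garding's inequality: if the derivative of \<open>elsym k\<close> in the direction \<open>v\<close>
  is at most \<open>C\<close> times its value, then each of the \<open>k\<close> ratios of \<open>v\<close> is at most \<open>C\<close> times
  the corresponding ratio of \<open>w\<close>.\<close>

lemma elsym_le_of_derivative_le:
  assumes I: "finite I" and w: "pos_cone (Suc k) I w" and v: "pos_cone (Suc k) I v"
    and le: "(\<Sum>i\<in>I. v i * elsym k (I - {i}) w) \<le> C * elsym (Suc k) I w"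
  shows "elsym (Suc k) I v \<le> C ^ Suc k * elsym (Suc k) I w"
proof -
  have E: "elsym (Suc k) I w > 0" using w by (simp add: pos_cone_def)
  have rat: "elsym_ratio j I v \<le> C * elsym_ratio j I w" if j: "j < Suc k" for j
  proof -
    have rw: "elsym_ratio j I w > 0" using w j by (rule elsym_ratio_pos)
    define q where "q = elsym_ratio j I v / elsym_ratio j I w"
    \<comment> \<open>By \<open>elsym_add_ge\<close> with \<open>s * v\<close> in place of
      \<open>v\<close>, f is nonnegative for s > 0; as it vanishes at 0, its derivative there cannot
      be negative.\<close>
    define f where "f = (\<lambda>s. elsym (Suc k) I (\<lambda>i. w i + s * v i) - elsym (Suc k) I w * (1 + s * q))"
    have f: "0 \<le> f s" if s: "0 < s" for s
    proof -
      have "pos_cone (Suc k) I (\<lambda>i. s * v i)"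
        using v s by (auto simp: pos_cone_def elsym_scale)
      from elsym_add_ge[OF I w this j] show ?thesis
        using s by (simp add: f_def q_def elsym_ratio_def elsym_scale mult.assoc)
    qed
    have der: "(f has_real_derivative (\<Sum>i\<in>I. v i * elsym k (I - {i}) w) - elsym (Suc k) I w * q) (at 0)"
    proof -
      have "((\<lambda>s. elsym (Suc k) I (\<lambda>i. w i + s * v i)) has_real_derivative
        (\<Sum>i\<in>I. v i * elsym k (I - {i}) (\<lambda>i. w i + 0 * v i))) (at 0)"
        using I by (rule has_real_derivative_elsym) (auto intro!: derivative_eq_intros)
      then show ?thesis
        unfolding f_def by (auto intro!: derivative_eq_intros)
    qed
    have "0 \<le> (\<Sum>i\<in>I. v i * elsym k (I - {i}) w) - elsym (Suc k) I w * q"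
    proof (rule ccontr)
      assume "\<not> ?thesis"
      then obtain d where d: "0 < d" "\<And>h. 0 < h \<Longrightarrow> h < d \<Longrightarrow> f (0 + h) < f 0"
        using DERIV_neg_dec_right[OF der] by force
      have "f (d/2) < f 0" using d(1) d(2)[of "d/2"] by simp
      moreover have "f 0 = 0" by (simp add: f_def)
      ultimately show False using f[of "d/2"] d(1) by simp
    qed
    then have "elsym (Suc k) I w * q \<le> elsym (Suc k) I w * C"
      using le by (simp add: mult.commute)
    then have "q \<le> C" using E by simp
    then show ?thesis using rw by (simp add: q_def field_simps)
  qed
  have "elsym (Suc k) I v = (\<Prod>j<Suc k. elsym_ratio j I v)"
    by (rule elsym_eq_prod_ratio[OF I v])
  also have "\<dots> \<le> (\<Prod>j<Suc k. C * elsym_ratio j I w)"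
    using rat elsym_ratio_pos[OF v] by (intro prod_mono) (auto intro: less_imp_le)
  also have "\<dots> = C ^ Suc k * elsym (Suc k) I w"
    unfolding prod.distrib elsym_eq_prod_ratio[OF I w] by simp
  finally show ?thesis .
qed

section \<open>Sums of principal minors\<close>

definition pminors :: "nat \<Rightarrow> real^'n^'n \<Rightarrow> real" where
  "pminors k A = (\<Sum>S | card S = k. \<Sum>p | p permutes S. of_int (sign p) * (\<Prod>i\<in>S. A $ i $ p i))"

text \<open>In Leibniz' formula each row contributes its entry of t A or its entry of the identity.
  If S is the set of rows of the first kind, only permutations fixing all points outside S survive,
  and these are the permutations of S.\<close>

lemma det_mat_1_plus:
  fixes A :: "real^'n^'n"
  shows "det (mat 1 + t *\<^sub>R A) = (\<Sum>k\<le>CARD('n). pminors k A * t ^ k)"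
proof -
  have "det (mat 1 + t *\<^sub>R A) = (\<Sum>p | p permutes (UNIV :: 'n set). \<Sum>S\<in>UNIV.
      of_int (sign p) * ((\<Prod>i\<in>S. t * A $ i $ p i) * (\<Prod>i\<in>-S. if i = p i then 1 else 0)))"
    unfolding det_def
    by (simp add: mat_def prod_add add.commute[of "if _ then _ else _"] sum_distrib_left Compl_eq_Diff_UNIV)
  also have "\<dots> = (\<Sum>S\<in>UNIV. \<Sum>p | p permutes (UNIV :: 'n set).
      of_int (sign p) * ((\<Prod>i\<in>S. t * A $ i $ p i) * (\<Prod>i\<in>-S. if i = p i then 1 else 0)))"
    by (rule sum.swap)
  also have "\<dots> = (\<Sum>S\<in>UNIV. t ^ card S * (\<Sum>p | p permutes S. of_int (sign p) * (\<Prod>i\<in>S. A $ i $ p i)))"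
  proof (rule sum.cong)
    fix S :: "'n set"
    have "(\<Sum>p | p permutes (UNIV :: 'n set).
        of_int (sign p) * ((\<Prod>i\<in>S. t * A $ i $ p i) * (\<Prod>i\<in>-S. if i = p i then 1 else 0)))
      = (\<Sum>p | p permutes S. of_int (sign p) * ((\<Prod>i\<in>S. t * A $ i $ p i) * (\<Prod>i\<in>-S. if i = p i then 1 else 0)))"
    proof (rule sum.mono_neutral_right)
      show "{p. p permutes S} \<subseteq> {p. p permutes (UNIV :: 'n set)}"
        by (auto intro: permutes_subset)
      show "\<forall>p\<in>{p. p permutes UNIV} - {p. p permutes S}.
          of_int (sign p) * ((\<Prod>i\<in>S. t * A $ i $ p i) * (\<Prod>i\<in>-S. if i = p i then 1 else 0)) = 0"
      proof
        fix p assume p: "p \<in> {p. p permutes (UNIV :: 'n set)} - {p. p permutes S}"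
        then obtain i where "i \<in> - S" "p i \<noteq> i"
          using permutes_superset[of p UNIV S] by auto
        then have "(\<Prod>i\<in>-S. if i = p i then 1 else 0 :: real) = 0"
          by (intro prod_zero) (auto intro!: bexI[of _ i])
        then show "of_int (sign p) * ((\<Prod>i\<in>S. t * A $ i $ p i) * (\<Prod>i\<in>-S. if i = p i then 1 else 0)) = 0"
          by simp
      qed
    qed simp
    also have "\<dots> = (\<Sum>p | p permutes S. t ^ card S * (of_int (sign p) * (\<Prod>i\<in>S. A $ i $ p i)))"
    proof (rule sum.cong)
      fix p assume "p \<in> {p. p permutes S}"
      then have "(\<Prod>i\<in>-S. if i = p i then 1 else 0 :: real) = 1"
        by (intro prod.neutral) (auto simp: permutes_def)
      then show "of_int (sign p) * ((\<Prod>i\<in>S. t * A $ i $ p i) * (\<Prod>i\<in>-S. if i = p i then 1 else 0))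
          = t ^ card S * (of_int (sign p) * (\<Prod>i\<in>S. A $ i $ p i))"
        by (simp add: prod.distrib)
    qed simp
    finally show "(\<Sum>p | p permutes (UNIV :: 'n set).
        of_int (sign p) * ((\<Prod>i\<in>S. t * A $ i $ p i) * (\<Prod>i\<in>-S. if i = p i then 1 else 0)))
      = t ^ card S * (\<Sum>p | p permutes S. of_int (sign p) * (\<Prod>i\<in>S. A $ i $ p i))"
      by (simp add: sum_distrib_left)
  qed simp
  also have "\<dots> = (\<Sum>k\<le>CARD('n). \<Sum>S | S \<in> UNIV \<and> card S = k.
      t ^ card S * (\<Sum>p | p permutes S. of_int (sign p) * (\<Prod>i\<in>S. A $ i $ p i)))"
    by (rule sum.group[symmetric]) (auto intro: card_mono)
  also have "\<dots> = (\<Sum>k\<le>CARD('n). pminors k A * t ^ k)"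
    unfolding pminors_def sum_distrib_right by (intro sum.cong) (auto simp: sum_distrib_left mult.commute)
  finally show ?thesis .
qed

text \<open>Comparing coefficients in t transfers every invariance of the determinant to
  \<open>pminors k\<close>, so that minors need not be conjugated directly.\<close>

lemma pminors_eqI:
  fixes A B :: "real^'n^'n"
  assumes "\<And>t. det (mat 1 + t *\<^sub>R A) = det (mat 1 + t *\<^sub>R B)" "k \<le> CARD('n)"
  shows "pminors k A = pminors k B"
  using assms polyfun_eq_coeffs[where c = "\<lambda>k. pminors k A" and d = "\<lambda>k. pminors k B"]
  unfolding det_mat_1_plus by blast

lemma matrix_add_rdistrib: "(A + B) ** C = A ** C + B ** (C :: 'a::semiring_1^'n^'m)"
  by (vector matrix_matrix_mult_def sum.distrib[symmetric] distrib_right)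

lemma pminors_orthogonal:
  fixes A Q :: "real^'n^'n"
  assumes Q: "orthogonal_matrix Q" and k: "k \<le> CARD('n)"
  shows "pminors k (transpose Q ** A ** Q) = pminors k A"
proof (rule pminors_eqI[OF _ k])
  fix t :: real
  have QQ: "transpose Q ** Q = mat 1" "Q ** transpose Q = mat 1"
    using Q by (auto simp: orthogonal_matrix_def)
  have "transpose Q ** (mat 1 + t *\<^sub>R A) ** Q = transpose Q ** (Q + t *\<^sub>R (A ** Q))"
    by (simp add: matrix_add_rdistrib scalar_matrix_assoc flip: matrix_mul_assoc)
  also have "\<dots> = mat 1 + t *\<^sub>R (transpose Q ** A ** Q)"
    by (simp add: matrix_add_ldistrib matrix_scalar_ac QQ scalar_matrix_assoc matrix_mul_assoc)
  finally have "transpose Q ** (mat 1 + t *\<^sub>R A) ** Q = mat 1 + t *\<^sub>R (transpose Q ** A ** Q)" .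
  then have "det (mat 1 + t *\<^sub>R (transpose Q ** A ** Q)) = det (transpose Q) * det (mat 1 + t *\<^sub>R A) * det Q"
    by (metis det_mul)
  also have "\<dots> = det (mat 1 + t *\<^sub>R A) * det (transpose Q ** Q)"
    by (simp add: det_mul)
  finally show "det (mat 1 + t *\<^sub>R (transpose Q ** A ** Q)) = det (mat 1 + t *\<^sub>R A)"
    by (simp add: QQ)
qed

lemma pminors_split:
  fixes A :: "real^'n^'n"
  shows "pminors k A = elsym k UNIV (\<lambda>i. A $ i $ i)
    + (\<Sum>S | card S = k. \<Sum>p | p permutes S \<and> p \<noteq> id. of_int (sign p) * (\<Prod>i\<in>S. A $ i $ p i))"
proof -
  have "(\<Sum>p | p permutes S. of_int (sign p) * (\<Prod>i\<in>S. A $ i $ p i)) = (\<Prod>i\<in>S. A $ i $ i)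
      + (\<Sum>p | p permutes S \<and> p \<noteq> id. of_int (sign p) * (\<Prod>i\<in>S. A $ i $ p i))" for S :: "'n set"
  proof -
    have eq: "{p. p permutes S} - {id} = {p. p permutes S \<and> p \<noteq> id}" by auto
    show ?thesis
      by (subst sum.remove[of _ id]) (auto simp: permutes_id eq)
  qed
  then show ?thesis
    by (simp add: pminors_def elsym_def sum.distrib)
qed

text \<open>A permutation other than the identity moves at least two points, so that each
  off-diagonal term vanishes to second order at a diagonal matrix.\<close>

lemma prod_offdiag_zero:
  fixes A :: "real^'n^'n"
  assumes diag: "\<And>i j. i \<noteq> j \<Longrightarrow> A $ i $ j = 0" and p: "p permutes S" "p \<noteq> id"
  shows "(\<Prod>j\<in>S - {i}. A $ j $ p j) = 0"
proof -
  obtain j where j: "p j \<noteq> j" using p(2) by (auto simp: fun_eq_iff)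
  have S: "j \<in> S" "p j \<in> S" using p(1) j by (auto simp: permutes_def permutes_in_image)
  have "p (p j) \<noteq> p j"
    using j permutes_inj[OF p(1)] by (auto dest: injD)
  then obtain l where "l \<in> S - {i}" "p l \<noteq> l"
    using j S by (cases "j = i") auto
  then show ?thesis
    using diag by (intro prod_zero) (auto intro!: bexI[of _ l])
qed

lemma pminors_diag:
  fixes A :: "real^'n^'n"
  assumes "\<And>i j. i \<noteq> j \<Longrightarrow> A $ i $ j = 0"
  shows "pminors k A = elsym k UNIV (\<lambda>i. A $ i $ i)"
proof -
  have "(\<Prod>j\<in>S. A $ j $ p j) = 0" if p: "p permutes S" "p \<noteq> id" for p and S :: "'n set"
  proof -
    obtain i where i: "p i \<noteq> i" using p(2) by (auto simp: fun_eq_iff)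
    then have "i \<in> S" using p(1) by (auto simp: permutes_def)
    then show ?thesis
      using prod_offdiag_zero[OF assms p, of i] by (simp add: prod.remove)
  qed
  then show ?thesis
    unfolding pminors_split by (simp del: prod_zero_iff)
qed

text \<open>In the term of a permutation other than the identity, differentiating one factor leaves
  another off-diagonal factor, which is 0 at the parameter \<open>s\<close>. Hence only the diagonal
  of \<open>N\<close> contributes, although \<open>A\<close> may be far from diagonal at other
  parameters.\<close>

lemma has_real_derivative_pminors:
  fixes A :: "real \<Rightarrow> real^'n^'n"
  assumes der: "\<And>i j. ((\<lambda>s. A s $ i $ j) has_real_derivative N i j) (at s)"
    and diag: "\<And>i j. i \<noteq> j \<Longrightarrow> A s $ i $ j = 0"
  shows "((\<lambda>s. pminors (Suc k) (A s)) has_real_derivative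
    (\<Sum>i\<in>UNIV. N i i * elsym k (UNIV - {i}) (\<lambda>i. A s $ i $ i))) (at s)"
proof -
  have 1: "((\<lambda>s. elsym (Suc k) UNIV (\<lambda>i. A s $ i $ i)) has_real_derivative
    (\<Sum>i\<in>UNIV. N i i * elsym k (UNIV - {i}) (\<lambda>i. A s $ i $ i))) (at s)"
    using der by (intro has_real_derivative_elsym) auto
  have 2: "((\<lambda>s. of_int (sign p) * (\<Prod>i\<in>S. A s $ i $ p i)) has_real_derivative 0) (at s)"
    if p: "p permutes S" "p \<noteq> id" for p and S :: "'n set"
  proof -
    have "((\<lambda>s. \<Prod>i\<in>S. A s $ i $ p i) has_real_derivative
        (\<Sum>i\<in>S. N i (p i) * (\<Prod>j\<in>S - {i}. A s $ j $ p j))) (at s)"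
      using der by (intro has_field_derivative_prod) auto
    then have "((\<lambda>s. \<Prod>i\<in>S. A s $ i $ p i) has_real_derivative 0) (at s)"
      by (simp add: prod_offdiag_zero[OF diag p])
    then show ?thesis
      by (auto intro!: derivative_eq_intros)
  qed
  have "((\<lambda>s. \<Sum>S | card S = Suc k. \<Sum>p | p permutes S \<and> p \<noteq> id.
      of_int (sign p) * (\<Prod>i\<in>S. A s $ i $ p i)) has_real_derivative
      (\<Sum>S :: 'n set | card S = Suc k. \<Sum>p | p permutes S \<and> p \<noteq> id. 0)) (at s)"
    by (intro DERIV_sum) (auto intro!: 2)
  from DERIV_add[OF 1 this] show ?thesis
    by (simp add: pminors_split)
qed

lemma pminors_sym_eigs:
  fixes A :: "real^'n^'n"
  assumes "sym_eigs A l" "k \<le> CARD('n)"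
  shows "pminors k A = esym k l"
proof -
  obtain Q where Q: "orthogonal_matrix Q" and A: "A = Q ** diag_mat l ** transpose Q"
    using assms(1) by (auto simp: sym_eigs_def)
  have QQ: "transpose Q ** Q = mat 1"
    using Q by (auto simp: orthogonal_matrix_def)
  have "transpose Q ** A ** Q = (transpose Q ** Q) ** diag_mat l ** (transpose Q ** Q)"
    unfolding A by (simp add: matrix_mul_assoc)
  then have "transpose Q ** A ** Q = diag_mat l" by (simp add: QQ)
  then have "pminors k A = pminors k (diag_mat l)"
    using pminors_orthogonal[OF Q assms(2), of A] by simp
  also have "\<dots> = elsym k UNIV (\<lambda>i. l $ i)"
    by (subst pminors_diag) (auto simp: diag_mat_def)
  finally show ?thesis
    by (simp add: esym_def elsym_def)
qed

text \<open>With F_i the partial derivatives, k + 1 + 3 c bounds the relative derivative in the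
  direction \<open>x\<close>: k + 1 comes from Euler's identity, c from the sum of F_i t, and 2 c
  from the sum of - F_i A_i over the indices other than \<open>a\<close>.\<close>

lemma elsym_gradient_bound:
  assumes I: "finite I" "a \<in> I" "Suc k \<le> card I" and A: "pos_cone (Suc k) I A"
    and Aa: "A a = 1 + t\<^sup>2" and t: "1 \<le> t" and c: "0 \<le> c"
    and ineq: "(\<Sum>i\<in>I - {a}. elsym k (I - {i}) A * ((A i - 1)\<^sup>2 + t\<^sup>2)) \<le> c * t * elsym (Suc k) I A"
    and le: "elsym (Suc k) I A \<le> D * t ^ Suc k"
  shows "t \<le> (real (Suc k) + 3 * c) ^ Suc k * D"
proof -
  define F where "F = (\<lambda>i. elsym k (I - {i}) A)"
  define E where "E = elsym (Suc k) I A"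
  have F: "F i > 0" if "i \<in> I" for i
    using pos_cone_restrict[OF I(1) that A] by (simp add: F_def pos_cone_def)
  have E: "E > 0" using A by (simp add: E_def pos_cone_def)
  define x where "x = (\<lambda>i. if i = a then A a else t)"
  have ineq': "(\<Sum>i\<in>I - {a}. F i * ((A i - 1)\<^sup>2 + t\<^sup>2)) \<le> c * t * E"
    using ineq by (simp add: F_def E_def)
  have "t * (\<Sum>i\<in>I - {a}. F i * t) \<le> (\<Sum>i\<in>I - {a}. F i * ((A i - 1)\<^sup>2 + t\<^sup>2))"
    unfolding sum_distrib_left
  proof (rule sum_mono)
    fix i assume i: "i \<in> I - {a}"
    have "F i * t\<^sup>2 \<le> F i * ((A i - 1)\<^sup>2 + t\<^sup>2)"
      using F[of i] i by (intro mult_left_mono) auto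
    then show "t * (F i * t) \<le> F i * ((A i - 1)\<^sup>2 + t\<^sup>2)"
      by (simp add: power2_eq_square mult_ac)
  qed
  then have "t * (\<Sum>i\<in>I - {a}. F i * t) \<le> t * (c * E)"
    using ineq' by (simp add: mult_ac)
  then have s1: "(\<Sum>i\<in>I - {a}. F i * t) \<le> c * E"
    using t by simp
  \<comment> \<open>The \<open>A i\<close> may be negative here; completing a square bounds - t A_i
    by 2 ((A_i - 1)^2 + t^2).\<close>
  have "t * (\<Sum>i\<in>I - {a}. - (F i * A i)) \<le> (\<Sum>i\<in>I - {a}. 2 * (F i * ((A i - 1)\<^sup>2 + t\<^sup>2)))"
    unfolding sum_distrib_left
  proof (rule sum_mono)
    fix i assume i: "i \<in> I - {a}"
    define b where "b = A i - 1"
    have "0 \<le> (b + t)\<^sup>2" by simp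
    then have "- (t * b) \<le> b\<^sup>2 + t\<^sup>2"
      using zero_le_power2[of b] zero_le_power2[of t] unfolding power2_sum by (simp only: mult.commute[of t b])
    moreover have "t * A i = t * b + t" by (simp add: b_def algebra_simps)
    ultimately have "- (t * A i) \<le> 2 * ((A i - 1)\<^sup>2 + t\<^sup>2)"
      using t zero_le_power2[of b] zero_le_power2[of t] unfolding b_def[symmetric] by argo
    then have "F i * - (t * A i) \<le> F i * (2 * ((A i - 1)\<^sup>2 + t\<^sup>2))"
      using F[of i] i by (intro mult_left_mono) auto
    then show "t * - (F i * A i) \<le> 2 * (F i * ((A i - 1)\<^sup>2 + t\<^sup>2))"
      by (simp add: mult_ac)
  qed
  also have "\<dots> = 2 * (\<Sum>i\<in>I - {a}. F i * ((A i - 1)\<^sup>2 + t\<^sup>2))"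
    by (simp only: sum_distrib_left)
  also have "\<dots> \<le> t * (2 * c * E)"
    using ineq' by (simp only: mult_ac)
  finally have s2: "(\<Sum>i\<in>I - {a}. - (F i * A i)) \<le> 2 * c * E"
    using t by simp
  \<comment> \<open>The assumed inequality does not see F_a; Euler's identity expresses A_a F_a
    through the other indices.\<close>
  have "(\<Sum>i\<in>I. A i * F i) = real (Suc k) * E"
    unfolding F_def E_def by (rule elsym_euler[OF I(1)])
  then have s3: "A a * F a = real (Suc k) * E + (\<Sum>i\<in>I - {a}. - (F i * A i))"
    using I by (simp add: sum.remove[of I a] sum_negf mult.commute)
  have "(\<Sum>i\<in>I. x i * F i) = A a * F a + (\<Sum>i\<in>I - {a}. F i * t)"
    using I by (simp add: sum.remove[of I a] x_def mult.commute)
  also have "\<dots> \<le> (real (Suc k) + 3 * c) * E"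
    unfolding s3 using s1 s2 by (simp add: algebra_simps)
  finally have fx: "(\<Sum>i\<in>I. x i * elsym k (I - {i}) A) \<le> (real (Suc k) + 3 * c) * elsym (Suc k) I A"
    by (simp add: F_def E_def)
  have xpos: "x i > 0" for i
    using t Aa by (simp add: x_def add_pos_nonneg)
  have "pos_cone (Suc k) I x"
    unfolding pos_cone_def using I xpos by (auto intro!: elsym_pos)
  from elsym_le_of_derivative_le[OF I(1) A this fx]
  have 1: "elsym (Suc k) I x \<le> (real (Suc k) + 3 * c) ^ Suc k * E"
    by (simp add: E_def)
  \<comment> \<open>A single product of order k + 1 containing \<open>a\<close> suffices: it is A_a
    t^k, at least t^(k+2), which is one power of t more than in
    \<open>D * t ^ Suc k\<close>.\<close>
  have "k \<le> card (I - {a})" using I by simp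
  then obtain S where S: "S \<subseteq> I - {a}" "card S = k"
    using obtain_subset_with_card_n by metis
  have finS: "finite S" using S I(1) by (meson finite_Diff finite_subset)
  have "prod x (insert a S) = A a * t ^ k"
  proof -
    have "prod x S = (\<Prod>i\<in>S. t)" using S by (intro prod.cong) (auto simp: x_def)
    then show ?thesis using S finS by (subst prod.insert) (auto simp: x_def)
  qed
  moreover have "card (insert a S) = Suc k" using S finS by (auto simp: card_insert_if)
  ultimately have 2: "A a * t ^ k \<le> elsym (Suc k) I x"
    using elsym_ge_prod[OF I(1), of "insert a S" x] S I xpos by (auto intro: less_imp_le)
  have "t * t ^ Suc k = t\<^sup>2 * t ^ k" by (simp add: power2_eq_square)
  also have "\<dots> \<le> A a * t ^ k" using t Aa by (intro mult_right_mono) auto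
  also have "\<dots> \<le> (real (Suc k) + 3 * c) ^ Suc k * E" using 1 2 by simp
  also have "\<dots> \<le> (real (Suc k) + 3 * c) ^ Suc k * (D * t ^ Suc k)"
    using le c unfolding E_def by (intro mult_left_mono) auto
  finally have "t * t ^ Suc k \<le> ((real (Suc k) + 3 * c) ^ Suc k * D) * t ^ Suc k"
    by (simp add: mult_ac)
  then show ?thesis using t by (simp del: power_Suc)
qed

section \<open>Orthonormal eigenbases of symmetric matrices\<close>

lemma symmetric_matrix_inner:
  fixes W :: "real^'n^'n"
  shows "transpose W = W \<Longrightarrow> x \<bullet> (W *v y) = (W *v x) \<bullet> y"
  by (metis dot_lmul_matrix vector_transpose_matrix)

text \<open>The vector maximises the Rayleigh quotient on the unit sphere of the orthogonal
  complement \<open>V\<close> of the given eigenvectors; symmetry of \<open>W\<close> makes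
  \<open>V\<close> invariant.\<close>

lemma eigenvector_orthogonal_to:
  fixes W :: "real^'n^'n" and q :: "'n \<Rightarrow> real^'n"
  assumes sym: "transpose W = W" and I: "I \<noteq> UNIV"
    and eig: "\<And>i. i \<in> I \<Longrightarrow> W *v q i = l i *\<^sub>R q i"
  obtains v c where "norm v = 1" "\<And>i. i \<in> I \<Longrightarrow> q i \<bullet> v = 0" "W *v v = c *\<^sub>R v"
proof -
  define V where "V = {v. \<forall>i\<in>I. q i \<bullet> v = 0}"
  have subV: "subspace V"
    unfolding subspace_def V_def by (auto simp: inner_right_distrib)
  have WV: "W *v v \<in> V" if "v \<in> V" for v
    using that eig by (auto simp: V_def symmetric_matrix_inner[OF sym])
  have "dim (q ` I) \<le> card (q ` I)" by (rule dim_le_card') simp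
  also have "\<dots> \<le> card I" by (rule card_image_le) simp
  also have "\<dots> < CARD('n)" using I by (intro psubset_card_mono) auto
  finally obtain z where z: "z \<noteq> 0" "\<And>y. y \<in> span (q ` I) \<Longrightarrow> orthogonal z y"
    using orthogonal_to_subspace_exists[of "q ` I"] by auto
  have zV: "z \<in> V"
    using z(2) by (auto simp: V_def span_base orthogonal_def inner_commute[of _ z])
  define K where "K = V \<inter> sphere 0 1"
  have "closed V" by (rule closed_subspace[OF subV])
  then have "compact K" unfolding K_def by (metis compact_sphere closed_Int_compact)
  moreover have "(1 / norm z) *\<^sub>R z \<in> K"
    using z(1) subspace_scale[OF subV zV] by (simp add: K_def)
  then have "K \<noteq> {}" by auto
  moreover have "continuous_on K (\<lambda>v. v \<bullet> (W *v v))"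
    by (intro continuous_intros linear_continuous_on matrix_vector_mul_bounded_linear)
  ultimately obtain v where v: "v \<in> K" "\<And>w. w \<in> K \<Longrightarrow> w \<bullet> (W *v w) \<le> v \<bullet> (W *v v)"
    using continuous_attains_sup[of K "\<lambda>v. v \<bullet> (W *v v)"] by blast
  have vV: "v \<in> V" and nv: "norm v = 1" using v(1) by (auto simp: K_def)
  define c where "c = v \<bullet> (W *v v)"
  have bound: "w \<bullet> (W *v w) \<le> c * (w \<bullet> w)" if "w \<in> V" for w
  proof (cases "w = 0")
    case False
    define e where "e = (1 / norm w) *\<^sub>R w"
    have "e \<in> K" using that False subspace_scale[OF subV that] by (simp add: K_def e_def)
    from v(2)[OF this] have "(w \<bullet> (W *v w)) / (norm w)\<^sup>2 \<le> c"
      by (simp add: e_def c_def matrix_vector_mult_scaleR power2_eq_square)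
    then show ?thesis using False by (simp add: divide_simps power2_norm_eq_inner)
  qed simp
  \<comment> \<open>The residual of the eigenvalue equation. Moving v along r would raise the
    quotient to first order, unless r = 0.\<close>
  define r where "r = W *v v - c *\<^sub>R v"
  have rV: "r \<in> V" unfolding r_def by (intro subspace_diff subspace_scale subV WV vV)
  have vv: "v \<bullet> v = 1" using nv by (simp add: norm_eq_1)
  have rv: "r \<bullet> v = 0" by (simp add: r_def inner_diff_left c_def vv inner_commute[of "W *v v"])
  have vr: "v \<bullet> r = 0" using rv by (simp add: inner_commute)
  have rWv: "r \<bullet> (W *v v) = r \<bullet> r"
  proof -
    have "W *v v = r + c *\<^sub>R v" by (simp add: r_def)
    then show ?thesis using rv by (simp add: inner_add_right)
  qed
  have vWr: "v \<bullet> (W *v r) = r \<bullet> r"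
    using rWv symmetric_matrix_inner[OF sym, of v r] by (simp add: inner_commute)
  have "2 * (r \<bullet> r) \<le> t * (c * (r \<bullet> r) - r \<bullet> (W *v r))" if t: "t > 0" for t
  proof -
    have "v + t *\<^sub>R r \<in> V" by (intro subspace_add subspace_scale subV rV vV)
    from bound[OF this]
    have "c + 2 * t * (r \<bullet> r) + t\<^sup>2 * (r \<bullet> (W *v r)) \<le> c * (1 + t\<^sup>2 * (r \<bullet> r))"
      by (simp add: matrix_vector_right_distrib matrix_vector_mult_scaleR inner_add_left
          inner_add_right rv vr rWv vWr vv power2_eq_square algebra_simps flip: c_def)
    then have "t * (2 * (r \<bullet> r)) \<le> t * (t * (c * (r \<bullet> r) - r \<bullet> (W *v r)))"
      by (simp add: power2_eq_square algebra_simps)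
    then show ?thesis using t by simp
  qed
  moreover have "\<exists>t>0. t * B < 2 * (r \<bullet> r)" if "r \<noteq> 0" for B
  proof -
    have "r \<bullet> r > 0" using that by simp
    then have "(r \<bullet> r / (\<bar>B\<bar> + 1)) * B < 2 * (r \<bullet> r)"
      by (smt (verit) divide_le_eq mult.commute mult_le_cancel_left_pos times_divide_eq_left)
    moreover have "r \<bullet> r / (\<bar>B\<bar> + 1) > 0" using \<open>r \<bullet> r > 0\<close> by (simp add: add_nonneg_pos)
    ultimately show ?thesis by blast
  qed
  ultimately have "r = 0" by (meson not_le)
  then have "W *v v = c *\<^sub>R v" by (simp add: r_def)
  then show ?thesis using that[of v c] nv vV by (auto simp: V_def)
qed

text \<open>Prescribed eigenvectors are kept because the normal x and the direction of the gradient
  have to be members of the basis.\<close>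

lemma orthonormal_eigenbasis_extend:
  fixes W :: "real^'n^'n" and q :: "'n \<Rightarrow> real^'n"
  assumes sym: "transpose W = W"
    and orth: "\<And>i j. i \<in> I \<Longrightarrow> j \<in> I \<Longrightarrow> q i \<bullet> q j = (if i = j then 1 else 0)"
    and eig: "\<And>i. i \<in> I \<Longrightarrow> W *v q i = l i *\<^sub>R q i"
  obtains q' l' where "\<And>i. i \<in> I \<Longrightarrow> q' i = q i" "\<And>i. i \<in> I \<Longrightarrow> l' i = l i"
    "\<And>i j. q' i \<bullet> q' j = (if i = j then 1 else 0)" "\<And>i. W *v q' i = l' i *\<^sub>R q' i"
  using orth eig
proof (induction "card (- I)" arbitrary: I q l thesis)
  case 0
  then have "I = UNIV" by auto
  with 0 show ?case by (metis UNIV_I)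
next
  case (Suc n)
  then obtain a where a: "a \<notin> I" by (metis ComplD card.empty ex_in_conv old.nat.distinct(2))
  obtain v c where v: "norm v = 1" "\<And>i. i \<in> I \<Longrightarrow> q i \<bullet> v = 0" "W *v v = c *\<^sub>R v"
    using eigenvector_orthogonal_to[OF sym, of I q l] a Suc.prems(3) by (metis UNIV_I)
  have n: "n = card (- insert a I)"
    using Suc.hyps(2) a by (simp add: Compl_insert card_Diff_singleton)
  have vv: "v \<bullet> v = 1" using v(1) by (simp add: norm_eq_1)
  obtain q' l' where q': "\<And>i. i \<in> insert a I \<Longrightarrow> q' i = (q(a := v)) i"
    "\<And>i. i \<in> insert a I \<Longrightarrow> l' i = (l(a := c)) i"
    "\<And>i j. q' i \<bullet> q' j = (if i = j then 1 else 0)" "\<And>i. W *v q' i = l' i *\<^sub>R q' i"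
  proof (rule Suc.hyps(1)[OF n])
    fix i j assume "i \<in> insert a I" "j \<in> insert a I"
    then show "(q(a := v)) i \<bullet> (q(a := v)) j = (if i = j then 1 else 0)"
      using a Suc.prems(2) v(2) vv by (auto simp: inner_commute)
  next
    fix i assume "i \<in> insert a I"
    then show "W *v (q(a := v)) i = (l(a := c)) i *\<^sub>R (q(a := v)) i"
      using Suc.prems(3) v(3) by auto
  qed blast
  show ?case
  proof (rule Suc.prems(1))
    show "q' i = q i" "l' i = l i" if "i \<in> I" for i
      using q'(1,2)[of i] that a by auto
  qed (use q' in auto)
qed

definition basis_matrix :: "('n \<Rightarrow> real^'n) \<Rightarrow> real^'n^'n" where
  "basis_matrix q = (\<chi> i j. q j $ i)"

lemma orthogonal_basis_matrix:
  fixes q :: "'n::finite \<Rightarrow> real^'n"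
  assumes "\<And>i j. q i \<bullet> q j = (if i = j then 1 else 0)"
  shows "orthogonal_matrix (basis_matrix q)"
  unfolding orthogonal_matrix
  using assms
  by (simp add: vec_eq_iff matrix_matrix_mult_def transpose_def basis_matrix_def mat_def inner_vec_def)

lemma conjugate_basis_matrix:
  fixes q :: "'n::finite \<Rightarrow> real^'n"
  shows "(transpose (basis_matrix q) ** A ** basis_matrix q) $ i $ j = q i \<bullet> (A *v q j)"
proof -
  have "(transpose (basis_matrix q) ** A ** basis_matrix q) $ i $ j
      = (transpose (basis_matrix q) ** (A ** basis_matrix q)) $ i $ j"
    by (simp only: matrix_mul_assoc)
  then show ?thesis
    by (simp add: matrix_matrix_mult_def transpose_def basis_matrix_def inner_vec_def
        matrix_vector_mult_def)
qed

lemma pminors_orthonormal_basis: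
  fixes q :: "'n::finite \<Rightarrow> real^'n"
  assumes "\<And>i j. q i \<bullet> q j = (if i = j then 1 else 0)" "k \<le> CARD('n)"
  shows "pminors k A = pminors k (\<chi> i j. q i \<bullet> (A *v q j))"
proof -
  have "transpose (basis_matrix q) ** A ** basis_matrix q = (\<chi> i j. q i \<bullet> (A *v q j))"
    by (simp add: vec_eq_iff conjugate_basis_matrix)
  then show ?thesis
    using pminors_orthogonal[OF orthogonal_basis_matrix[OF assms(1)] assms(2), of A] by simp
qed

text \<open>The spectral theorem provides some diagonalisation, so the choice in
  \<open>eigvals\<close> is a genuine one, and \<open>pminors\<close> does not depend on which one
  is chosen.\<close>

lemma esym_eigvals:
  fixes W :: "real^'n^'n"
  assumes sym: "transpose W = W" and k: "k \<le> CARD('n)"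
  shows "esym k (eigvals W) = pminors k W"
proof -
  obtain q :: "'n \<Rightarrow> real^'n" and l
    where q: "\<And>i j. q i \<bullet> q j = (if i = j then 1 else 0)" "\<And>i. W *v q i = l i *\<^sub>R q i"
    by (rule orthonormal_eigenbasis_extend[OF sym, of "{}" "\<lambda>_. 0" "\<lambda>_. 0"]) blast+
  define Q where "Q = basis_matrix q"
  have Q: "orthogonal_matrix Q"
    unfolding Q_def using q(1) by (rule orthogonal_basis_matrix)
  then have QQ: "Q ** transpose Q = mat 1"
    by (auto simp: orthogonal_matrix_def)
  have "transpose Q ** W ** Q = diag_mat (\<chi> i. l i)"
    by (simp add: vec_eq_iff Q_def conjugate_basis_matrix q diag_mat_def)
  then have "Q ** diag_mat (\<chi> i. l i) ** transpose Q = (Q ** transpose Q) ** W ** (Q ** transpose Q)"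
    by (metis matrix_mul_assoc)
  then have "sym_eigs W (\<chi> i. l i)"
    using Q unfolding sym_eigs_def by (metis QQ matrix_mul_lid matrix_mul_rid)
  then have "sym_eigs W (eigvals W)"
    unfolding eigvals_def by (rule someI)
  then show ?thesis
    using pminors_sym_eigs[OF _ k] by metis
qed

lemma pminors_eigenbasis:
  fixes q :: "'n::finite \<Rightarrow> real^'n"
  assumes "\<And>i j. q i \<bullet> q j = (if i = j then 1 else 0)" "\<And>i. W *v q i = l i *\<^sub>R q i" "k \<le> CARD('n)"
  shows "pminors k W = elsym k UNIV l"
proof -
  have "pminors k W = pminors k (\<chi> i j. q i \<bullet> (W *v q j))"
    using assms(1,3) by (rule pminors_orthonormal_basis)
  also have "\<dots> = elsym k UNIV l"
    by (subst pminors_diag) (auto simp: assms(1,2))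
  finally show ?thesis .
qed

section \<open>Second derivatives\<close>

text \<open>If c were positive, f' would be positive just to the right of 0 and f would rise above
  its maximum.\<close>

lemma second_derivative_test:
  fixes f f' :: "real \<Rightarrow> real"
  assumes f: "\<And>s. (f has_real_derivative f' s) (at s)"
    and f': "(f' has_real_derivative c) (at 0)" and max: "\<And>s. f s \<le> f 0"
  shows "f' 0 = 0" and "c \<le> 0"
proof -
  show z: "f' 0 = 0"
    using DERIV_local_max[OF f, of 1] max by simp
  show "c \<le> 0"
  proof (rule ccontr)
    assume "\<not> c \<le> 0"
    then obtain d where d: "d > 0" "\<And>h. 0 < h \<Longrightarrow> h < d \<Longrightarrow> f' 0 < f' (0 + h)"
      using DERIV_pos_inc_right[OF f'] by auto
    have pos: "\<exists>y. (f has_real_derivative y) (at s) \<and> 0 < y" if "0 < s" "s < d/2" for s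
      using f[of s] d(2)[of s] that z by auto
    have "continuous_on {0..d/2} f"
      by (intro continuous_at_imp_continuous_on ballI DERIV_isCont[OF f])
    then have "f 0 < f (d/2)"
      using DERIV_pos_imp_increasing_open[of 0 "d/2" f] pos d(1) by simp
    then show False using max[of "d/2"] by simp
  qed
qed

text \<open>The second difference is an increment in the direction \<open>a\<close> of the increment
  of u in the direction \<open>b\<close>. The mean value theorem turns it into a difference of
  \<open>g\<close>, which the linearisation of \<open>g\<close> at x controls.\<close>

lemma second_difference_bound:
  fixes u :: "'a::real_inner \<Rightarrow> real"
  assumes S: "open S" "x \<in> S"
    and u: "\<And>y. y \<in> S \<Longrightarrow> (u has_derivative (\<lambda>h. g y \<bullet> h)) (at y)"
    and g: "(g has_derivative B) (at x)" and e: "e > 0"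
  shows "\<exists>s0>0. \<forall>s. 0 < s \<and> s < s0 \<longrightarrow>
    \<bar>u (x + s *\<^sub>R a + s *\<^sub>R b) - u (x + s *\<^sub>R a) - u (x + s *\<^sub>R b) + u x - s\<^sup>2 * (B b \<bullet> a)\<bar> \<le> e * s\<^sup>2"
proof -
  interpret B: bounded_linear B by (rule has_derivative_bounded_linear[OF g])
  define n where "n = norm a + norm b + 1"
  have n: "n > 0" by (simp add: n_def add_nonneg_pos)
  \<comment> \<open>Two remainders of size at most e' s n are paired with a vector of norm at most n
    and multiplied by s, which gives 2 n^2 e' s^2 = e s^2.\<close>
  define e' where "e' = e / (2 * n * n)"
  have e': "e' > 0" using e n by (simp add: e'_def)
  obtain d1 where d1: "d1 > 0" "\<And>y. norm (y - x) < d1 \<Longrightarrow> norm (g y - g x - B (y - x)) \<le> e' * norm (y - x)"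
    using g e' unfolding has_derivative_at_alt by blast
  obtain d2 where d2: "d2 > 0" "ball x d2 \<subseteq> S" using S open_contains_ball by blast
  define s0 where "s0 = min d1 d2 / n"
  have "s0 > 0" using d1 d2 n by (simp add: s0_def)
  moreover have "\<bar>u (x + s *\<^sub>R a + s *\<^sub>R b) - u (x + s *\<^sub>R a) - u (x + s *\<^sub>R b) + u x - s\<^sup>2 * (B b \<bullet> a)\<bar> \<le> e * s\<^sup>2"
    if s: "0 < s" "s < s0" for s
  proof -
    have sn: "s * n < min d1 d2" using s n by (simp add: s0_def pos_less_divide_eq)
    have near: "norm (r *\<^sub>R a + q *\<^sub>R b) \<le> s * n" if "0 \<le> r" "r \<le> s" "0 \<le> q" "q \<le> s" for r q
    proof -
      have "norm (r *\<^sub>R a + q *\<^sub>R b) \<le> r * norm a + q * norm b"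
        using norm_triangle_ineq[of "r *\<^sub>R a" "q *\<^sub>R b"] that by simp
      also have "\<dots> \<le> s * norm a + s * norm b"
        using that by (intro add_mono mult_right_mono) auto
      also have "\<dots> \<le> s * n" using s by (simp add: n_def algebra_simps)
      finally show ?thesis .
    qed
    have inS: "x + r *\<^sub>R a + q *\<^sub>R b \<in> S" if "0 \<le> r" "r \<le> s" "0 \<le> q" "q \<le> s" for r q
    proof -
      have "dist (x + (r *\<^sub>R a + q *\<^sub>R b)) x < d2"
        using near[OF that] sn by (simp add: dist_norm)
      then show ?thesis using d2(2) by (auto simp: add.assoc mem_ball dist_commute)
    qed
    define p where "p = (\<lambda>r. u (x + r *\<^sub>R a + s *\<^sub>R b) - u (x + r *\<^sub>R a + 0 *\<^sub>R b))"
    have der: "(p has_real_derivative (g (x + r *\<^sub>R a + s *\<^sub>R b) - g (x + r *\<^sub>R a + 0 *\<^sub>R b)) \<bullet> a) (at r)"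
      if r: "0 \<le> r" "r \<le> s" for r
    proof -
      have D: "((\<lambda>r. u (x + r *\<^sub>R a + q *\<^sub>R b)) has_derivative (\<lambda>h. g (x + r *\<^sub>R a + q *\<^sub>R b) \<bullet> (h *\<^sub>R a))) (at r)"
        if "0 \<le> q" "q \<le> s" for q
        by (rule has_derivative_compose[of "\<lambda>r. x + r *\<^sub>R a + q *\<^sub>R b", OF _ u])
          (auto intro!: derivative_eq_intros inS r that)
      have s0: "0 \<le> s" using s by simp
      show ?thesis
        unfolding p_def has_field_derivative_def
        by (rule has_derivative_eq_rhs[OF has_derivative_diff[OF D[OF s0 order_refl] D[OF order_refl s0]]])
          (simp add: fun_eq_iff inner_diff_left algebra_simps)
    qed
    obtain r where r: "0 < r" "r < s" and
      mvt: "p s - p 0 = (s - 0) * ((g (x + r *\<^sub>R a + s *\<^sub>R b) - g (x + r *\<^sub>R a + 0 *\<^sub>R b)) \<bullet> a)"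
      using MVT2[of 0 s p, OF s(1) der] by blast
    define R where "R = (\<lambda>q. g (x + r *\<^sub>R a + q *\<^sub>R b) - g x - B (r *\<^sub>R a + q *\<^sub>R b))"
    have R: "norm (R q) \<le> e' * (s * n)" if "0 \<le> q" "q \<le> s" for q
    proof -
      have "norm (r *\<^sub>R a + q *\<^sub>R b) \<le> s * n" using near[of r q] r that by simp
      then show ?thesis
        using d1(2)[of "x + (r *\<^sub>R a + q *\<^sub>R b)"] sn e'
        by (simp add: R_def add.assoc) (smt (verit) mult_left_mono)
    qed
    have eq: "g (x + r *\<^sub>R a + s *\<^sub>R b) - g (x + r *\<^sub>R a + 0 *\<^sub>R b) = s *\<^sub>R B b + (R s - R 0)"
      by (simp add: R_def B.add B.scaleR)
    have "u (x + s *\<^sub>R a + s *\<^sub>R b) - u (x + s *\<^sub>R a) - u (x + s *\<^sub>R b) + u x = p s - p 0"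
      by (simp add: p_def)
    also have "\<dots> = s\<^sup>2 * (B b \<bullet> a) + s * ((R s - R 0) \<bullet> a)"
      unfolding mvt eq by (simp add: inner_add_left power2_eq_square algebra_simps)
    finally have "\<bar>u (x + s *\<^sub>R a + s *\<^sub>R b) - u (x + s *\<^sub>R a) - u (x + s *\<^sub>R b) + u x - s\<^sup>2 * (B b \<bullet> a)\<bar>
        = s * \<bar>(R s - R 0) \<bullet> a\<bar>"
      using s by (simp add: abs_mult)
    also have "\<dots> \<le> s * ((2 * (e' * (s * n))) * n)"
    proof (intro mult_left_mono)
      have "\<bar>(R s - R 0) \<bullet> a\<bar> \<le> norm (R s - R 0) * norm a" by (rule Cauchy_Schwarz_ineq2)
      also have "\<dots> \<le> (2 * (e' * (s * n))) * n"
      proof (intro mult_mono)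
        show "norm (R s - R 0) \<le> 2 * (e' * (s * n))"
          using norm_triangle_ineq4[of "R s" "R 0"] R[of s] R[of 0] s by simp
      qed (use e' s n in \<open>auto simp: n_def\<close>)
      finally show "\<bar>(R s - R 0) \<bullet> a\<bar> \<le> (2 * (e' * (s * n))) * n" .
    qed (use s in simp)
    also have "\<dots> = e * s\<^sup>2" using n by (simp add: e'_def power2_eq_square)
    finally show ?thesis .
  qed
  ultimately show ?thesis by blast
qed

text \<open>The second difference is symmetric in \<open>a\<close> and \<open>b\<close>, so both
  second derivatives approximate it. Differentiability of the gradient at x suffices, which allows
  the use on components of \<open>g\<close>, where the second derivative is a derivative of
  \<open>H\<close> not known to be continuous.\<close>

lemma second_derivative_symmetric:
  fixes u :: "'a::real_inner \<Rightarrow> real"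
  assumes S: "open S" "x \<in> S"
    and u: "\<And>y. y \<in> S \<Longrightarrow> (u has_derivative (\<lambda>h. g y \<bullet> h)) (at y)"
    and g: "(g has_derivative B) (at x)"
  shows "B a \<bullet> b = B b \<bullet> a"
proof (rule ccontr)
  assume ne: "B a \<bullet> b \<noteq> B b \<bullet> a"
  define e where "e = \<bar>B a \<bullet> b - B b \<bullet> a\<bar> / 4"
  have e: "e > 0" using ne by (simp add: e_def)
  obtain s1 where s1: "s1 > 0" "\<And>s. 0 < s \<Longrightarrow> s < s1 \<Longrightarrow>
    \<bar>u (x + s *\<^sub>R a + s *\<^sub>R b) - u (x + s *\<^sub>R a) - u (x + s *\<^sub>R b) + u x - s\<^sup>2 * (B b \<bullet> a)\<bar> \<le> e * s\<^sup>2"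
    using second_difference_bound[OF S u g e, of a b] by blast
  obtain s2 where s2: "s2 > 0" "\<And>s. 0 < s \<Longrightarrow> s < s2 \<Longrightarrow>
    \<bar>u (x + s *\<^sub>R b + s *\<^sub>R a) - u (x + s *\<^sub>R b) - u (x + s *\<^sub>R a) + u x - s\<^sup>2 * (B a \<bullet> b)\<bar> \<le> e * s\<^sup>2"
    using second_difference_bound[OF S u g e, of b a] by blast
  define s where "s = min s1 s2 / 2"
  have s: "0 < s" "s < s1" "s < s2" using s1(1) s2(1) by (auto simp: s_def)
  have eq: "x + s *\<^sub>R b + s *\<^sub>R a = x + s *\<^sub>R a + s *\<^sub>R b" by simp
  have "\<bar>s\<^sup>2 * (B a \<bullet> b) - s\<^sup>2 * (B b \<bullet> a)\<bar> \<le> 2 * (e * s\<^sup>2)"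
    using s1(2)[OF s(1,2)] s2(2)[OF s(1,3), unfolded eq] by linarith
  then have "s\<^sup>2 * \<bar>B a \<bullet> b - B b \<bullet> a\<bar> \<le> s\<^sup>2 * (2 * e)"
    unfolding right_diff_distrib[symmetric] abs_mult by (simp add: mult_ac)
  then have "\<bar>B a \<bullet> b - B b \<bullet> a\<bar> \<le> 2 * e" using s by simp
  then show False using e by (simp add: e_def)
qed

section \<open>Calculus along great circles\<close>

lemma bounded_bilinear_matrix_matrix_mult:
  "bounded_bilinear ((**) :: real^'n^'m \<Rightarrow> real^'p^'n \<Rightarrow> real^'p^'m)"
proof -
  have "bilinear ((**) :: real^'n^'m \<Rightarrow> real^'p^'n \<Rightarrow> real^'p^'m)"
    unfolding bilinear_def
    by (auto intro!: linearI simp: matrix_add_ldistrib matrix_add_rdistrib matrix_scalar_ac scalar_matrix_assoc)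
  then show ?thesis
    by (simp add: bilinear_conv_bounded_bilinear)
qed

lemma bounded_bilinear_matrix_vector_mult:
  "bounded_bilinear ((*v) :: real^'n^'m \<Rightarrow> real^'n \<Rightarrow> real^'m)"
proof -
  have "bilinear ((*v) :: real^'n^'m \<Rightarrow> real^'n \<Rightarrow> real^'m)"
    unfolding bilinear_def
    by (auto intro!: linearI simp: matrix_vector_right_distrib matrix_vector_mult_add_rdistrib
        matrix_vector_mult_scaleR scaleR_matrix_vector_assoc)
  then show ?thesis
    by (simp add: bilinear_conv_bounded_bilinear)
qed

lemma matrix_vector_mult_minus_right: "A *v (- v) = - (A *v (v :: real^'n))"
  using matrix_vector_mult_scaleR[of A "-1" v] by simp

text \<open>For orthogonal unit vectors x and h this is the great circle through x with initial
  velocity h. Its velocity is \<open>circ'\<close> and its acceleration is \<open>- circ\<close>,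
  normal to the sphere.\<close>

definition circ :: "'a::real_vector \<Rightarrow> 'a \<Rightarrow> real \<Rightarrow> 'a" where
  "circ x h s = cos s *\<^sub>R x + sin s *\<^sub>R h"

definition circ' :: "'a::real_vector \<Rightarrow> 'a \<Rightarrow> real \<Rightarrow> 'a" where
  "circ' x h s = cos s *\<^sub>R h - sin s *\<^sub>R x"

lemma circ_0 [simp]: "circ x h 0 = x" "circ' x h 0 = h"
  by (simp_all add: circ_def circ'_def)

lemma has_vector_derivative_circ:
  fixes x h :: "'a::real_normed_vector"
  shows "(circ x h has_vector_derivative circ' x h s) (at s)"
    and "(circ' x h has_vector_derivative - circ x h s) (at s)"
proof -
  have "((\<lambda>s. cos s *\<^sub>R a + sin s *\<^sub>R b) has_vector_derivative cos s *\<^sub>R b - sin s *\<^sub>R a) (at s)"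
    for a b :: 'a
    by (rule has_vector_derivative_eq_rhs, rule has_vector_derivative_add)
      (rule has_vector_derivative_scaleR has_vector_derivative_const DERIV_cos DERIV_sin | simp)+
  from this[of x h] this[of h "- x"]
  show "(circ x h has_vector_derivative circ' x h s) (at s)"
    and "(circ' x h has_vector_derivative - circ x h s) (at s)"
    unfolding circ_def[abs_def] circ'_def[abs_def] by simp_all
qed

lemma has_vector_derivative_chain:
  assumes f: "(f has_derivative f') (at (c s))" and c: "(c has_vector_derivative v) (at s)"
  shows "((\<lambda>s. f (c s)) has_vector_derivative f' v) (at s)"
proof -
  interpret bounded_linear f' by (rule has_derivative_bounded_linear[OF f])
  show ?thesis
    using has_derivative_compose[OF c[unfolded has_vector_derivative_def] f]
    by (simp add: has_vector_derivative_def scaleR)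
qed

lemma circ_on_sphere:
  fixes x h :: "'a::real_inner"
  assumes "norm x = 1" "norm h = 1" "x \<bullet> h = 0"
  shows "norm (circ x h s) = 1" "circ x h s \<bullet> circ' x h s = 0" "norm (circ' x h s) = 1"
proof -
  have i: "x \<bullet> x = 1" "h \<bullet> h = 1" "h \<bullet> x = 0"
    using assms by (auto simp: norm_eq_1 inner_commute)
  have cs: "cos s * cos s + sin s * sin s = 1"
    using sin_cos_squared_add[of s] by (simp add: power2_eq_square)
  show "norm (circ x h s) = 1" "norm (circ' x h s) = 1"
    unfolding norm_eq_1 using i assms(3) cs
    by (simp_all add: circ_def circ'_def inner_add_left inner_add_right inner_diff_left inner_diff_right)
  show "circ x h s \<bullet> circ' x h s = 0"
    using i assms(3)
    by (simp add: circ_def circ'_def inner_add_left inner_diff_right)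
qed

lemma tproj_mult: "tproj x *v v = v - (x \<bullet> v) *\<^sub>R x"
  by (simp add: tproj_def matrix_vector_mult_diff_rdistrib)
    (simp add: vec_eq_iff matrix_vector_mult_def inner_vec_def sum_distrib_left mult_ac)

definition dproj :: "real^'m \<Rightarrow> real^'m \<Rightarrow> real^'m^'m" where
  "dproj x h = - (\<chi> i j. x $ i * h $ j + h $ i * x $ j)"

lemma dproj_mult: "dproj x h *v v = - ((x \<bullet> v) *\<^sub>R h + (h \<bullet> v) *\<^sub>R x)"
  by (simp add: dproj_def vec_eq_iff matrix_vector_mult_def inner_vec_def sum_distrib_left
      sum.distrib algebra_simps sum_negf sum_subtractf)

lemma has_derivative_tproj:
  fixes x :: "real^'m"
  shows "(tproj has_derivative dproj x) (at x)"
proof -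
  define outer :: "real^'m \<Rightarrow> real^'m \<Rightarrow> real^'m^'m" where "outer = (\<lambda>a b. \<chi> i j. a $ i * b $ j)"
  have "bilinear outer"
    unfolding bilinear_def outer_def by (auto intro!: linearI simp: vec_eq_iff algebra_simps)
  then have "bounded_bilinear outer"
    by (simp add: bilinear_conv_bounded_bilinear)
  from has_derivative_minus[OF bounded_bilinear.FDERIV[OF this has_derivative_ident has_derivative_ident]]
  have "((\<lambda>x. mat 1 + - outer x x) has_derivative (\<lambda>h. - (outer x h + outer h x))) (at x)"
    using has_derivative_add[OF has_derivative_const] by fastforce
  moreover have "(\<lambda>x. mat 1 + - outer x x) = tproj" "(\<lambda>h. - (outer x h + outer h x)) = dproj x"
    by (auto simp: fun_eq_iff tproj_def dproj_def outer_def vec_eq_iff)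
  ultimately show ?thesis by simp
qed

section \<open>Derivatives of the one-homogeneous extension and the Codazzi symmetry\<close>

locale sphere_fun =
  fixes u :: "real^'m \<Rightarrow> real" and g :: "real^'m \<Rightarrow> real^'m" and H :: "real^'m \<Rightarrow> real^'m^'m"
    and S :: "(real^'m) set"
  assumes open_S: "open S" and sphere_S: "sphere 0 1 \<subseteq> S"
    and du: "\<And>x. x \<in> S \<Longrightarrow> (u has_derivative (\<lambda>h. g x \<bullet> h)) (at x)"
    and dg: "\<And>x. x \<in> S \<Longrightarrow> (g has_derivative (\<lambda>h. H x *v h)) (at x)"
    and diff_H: "\<And>x. x \<in> S \<Longrightarrow> H differentiable (at x)"
begin

abbreviation "W \<equiv> hess_plus u g H"

text \<open>\<open>G\<close> is the gradient, and \<open>W\<close> the Hessian on the sphere, of the extension of \<open>u\<close> that is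
  homogeneous of degree one.\<close>

definition "G x = sgrad g x + u x *\<^sub>R x"

text \<open>The third derivative of u in the ambient space; \<open>T_sym1\<close> and
  \<open>T_sym2\<close> together make it symmetric in all three arguments.\<close>

definition "T x = frechet_derivative H (at x)"

lemma dH: "x \<in> S \<Longrightarrow> (H has_derivative T x) (at x)"
  using diff_H[of x] by (simp add: T_def frechet_derivative_works[symmetric])

lemma in_S: "norm x = 1 \<Longrightarrow> x \<in> S"
  using sphere_S by auto

lemma H_sym: "x \<in> S \<Longrightarrow> a \<bullet> (H x *v b) = b \<bullet> (H x *v a)"
  using second_derivative_symmetric[OF open_S _ du dg, of x a b] by (simp add: inner_commute)

lemma T_sym1: "x \<in> S \<Longrightarrow> a \<bullet> (T x h *v b) = b \<bullet> (T x h *v a)"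
proof -
  assume x: "x \<in> S"
  have D: "((\<lambda>y. a \<bullet> (H y *v b)) has_derivative (\<lambda>h. a \<bullet> (T x h *v b))) (at x)" for a b
    by (intro has_derivative_inner_right dH x
        bounded_linear.has_derivative[OF bounded_bilinear.bounded_linear_left[OF bounded_bilinear_matrix_vector_mult]])
  have "((\<lambda>y. b \<bullet> (H y *v a)) has_derivative (\<lambda>h. a \<bullet> (T x h *v b))) (at x)"
    by (rule has_derivative_transform_within_open[OF D open_S x]) (rule H_sym)
  from has_derivative_unique[OF this D] show ?thesis by meson
qed

lemma T_sym2: "x \<in> S \<Longrightarrow> T x a *v b = T x b *v a"
proof -
  assume x: "x \<in> S"
  have "T x a $ i \<bullet> b = T x b $ i \<bullet> a" for i
  proof (rule second_derivative_symmetric[OF open_S x])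
    show "((\<lambda>y. g y $ i) has_derivative (\<lambda>h. H y $ i \<bullet> h)) (at y)" if "y \<in> S" for y
      using bounded_linear.has_derivative[OF bounded_linear_vec_nth dg[OF that]]
      by (simp add: matrix_vector_mul_component)
    show "((\<lambda>y. H y $ i) has_derivative (\<lambda>h. T x h $ i)) (at x)"
      by (rule bounded_linear.has_derivative[OF bounded_linear_vec_nth dH[OF x]])
  qed
  then show ?thesis by (simp add: vec_eq_iff matrix_vector_mul_component)
qed

lemma W_mult: "W x *v b = tproj x *v (H x *v (tproj x *v b)) + (u x - g x \<bullet> x) *\<^sub>R (tproj x *v b)"
  by (simp add: hess_plus_def matrix_vector_mult_add_rdistrib matrix_vector_mul_assoc matrix_mul_assoc
      flip: scaleR_matrix_vector_assoc)

lemma tproj_inner: "a \<bullet> (tproj x *v b) = b \<bullet> (tproj x *v a)"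
  by (simp add: tproj_mult inner_diff_right inner_commute)

lemma W_sym: "x \<in> S \<Longrightarrow> a \<bullet> (W x *v b) = b \<bullet> (W x *v a)"
proof -
  assume x: "x \<in> S"
  have "c \<bullet> (tproj x *v (H x *v (tproj x *v d))) = (tproj x *v c) \<bullet> (H x *v (tproj x *v d))" for c d
    by (subst tproj_inner) (rule inner_commute)
  then show ?thesis
    unfolding W_mult inner_add_right inner_scaleR_right
    using H_sym[OF x, of "tproj x *v a"] tproj_inner[of a x b] by metis
qed

lemma W_transpose: "x \<in> S \<Longrightarrow> transpose (W x) = W x"
proof -
  assume x: "x \<in> S"
  have "W x $ i $ j = W x $ j $ i" for i j
    using W_sym[OF x, of "axis i 1" "axis j 1"]
    by (simp add: inner_axis' matrix_vector_mult_basis column_def)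
  then show ?thesis by (simp add: transpose_def vec_eq_iff)
qed

lemma tproj_self: "norm x = 1 \<Longrightarrow> tproj x *v x = 0"
  by (simp add: tproj_mult norm_eq_1)

lemma W_self: "norm x = 1 \<Longrightarrow> W x *v x = 0"
  by (simp add: W_mult tproj_self)

lemma G_eq: "G x = g x + (u x - g x \<bullet> x) *\<^sub>R x"
  by (simp add: G_def sgrad_def algebra_simps)

lemma G_inner_self: "norm x = 1 \<Longrightarrow> G x \<bullet> x = u x"
  by (simp add: G_eq inner_add_left norm_eq_1)

lemma inner_G_self: "norm x = 1 \<Longrightarrow> x \<bullet> G x = u x"
  using G_inner_self by (simp add: inner_commute)

lemma G_inner_tangent: "x \<bullet> h = 0 \<Longrightarrow> G x \<bullet> h = g x \<bullet> h"
  by (simp add: G_eq inner_add_left)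

lemma sgrad_inner_self: "norm x = 1 \<Longrightarrow> sgrad g x \<bullet> x = 0"
  by (simp add: sgrad_def inner_diff_left norm_eq_1)

lemma G_norm:
  assumes "norm x = 1"
  shows "(norm (G x))\<^sup>2 = (u x)\<^sup>2 + (norm (sgrad g x))\<^sup>2"
proof -
  have "sgrad g x \<bullet> x = 0" "x \<bullet> sgrad g x = 0" "x \<bullet> x = 1"
    using sgrad_inner_self[OF assms] assms by (simp_all add: inner_commute norm_eq_1)
  then show ?thesis
    unfolding G_def power2_norm_eq_inner power2_eq_square[of "u x"]
    by (simp add: inner_add_left inner_add_right)
qed

text \<open>The two terms \<open>g x \<bullet> h\<close>, from u and from
  \<open>g x \<bullet> x\<close>, cancel. Only tangent directions are treated: in general the
  formula for \<open>G\<close> is the gradient of the one-homogeneous extension on the sphere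
  alone.\<close>

lemma dG:
  assumes x: "norm x = 1" and h: "x \<bullet> h = 0"
  shows "\<exists>G'. (G has_derivative G') (at x) \<and> G' h = W x *v h"
proof -
  have xS: "x \<in> S" using x by (rule in_S)
  have "(G has_derivative (\<lambda>h. H x *v h + ((u x - g x \<bullet> x) *\<^sub>R h
      + (g x \<bullet> h - (g x \<bullet> h + (H x *v h) \<bullet> x)) *\<^sub>R x))) (at x)"
    unfolding G_eq[abs_def]
    by (intro has_derivative_add has_derivative_scaleR has_derivative_diff has_derivative_inner
        du dg xS has_derivative_ident)
  moreover have "H x *v h + ((u x - g x \<bullet> x) *\<^sub>R h
      + (g x \<bullet> h - (g x \<bullet> h + (H x *v h) \<bullet> x)) *\<^sub>R x) = W x *v h"
    using h by (simp add: W_mult tproj_mult inner_commute algebra_simps)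
  ultimately show ?thesis by blast
qed

text \<open>The derivative of \<open>W\<close> in the direction h. The product rule is left
  unsimplified, cancelling terms included, so that the derivative rules yield exactly this
  expression.\<close>

definition "N x h = (tproj x ** H x) ** dproj x h + (tproj x ** T x h + dproj x h ** H x) ** tproj x
  + ((u x - g x \<bullet> x) *\<^sub>R dproj x h + (g x \<bullet> h - (g x \<bullet> h + (H x *v h) \<bullet> x)) *\<^sub>R tproj x)"

lemma dW: "x \<in> S \<Longrightarrow> (W has_derivative N x) (at x)"
  unfolding hess_plus_def[abs_def] N_def[abs_def]
  by (intro has_derivative_add has_derivative_scaleR has_derivative_diff has_derivative_inner
      du dg dH has_derivative_ident has_derivative_tproj
      bounded_bilinear.FDERIV[OF bounded_bilinear_matrix_matrix_mult])

lemma N_mult: "N x h *v b = tproj x *v (H x *v (dproj x h *v b))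
   + (tproj x *v (T x h *v (tproj x *v b)) + dproj x h *v (H x *v (tproj x *v b)))
   + ((u x - g x \<bullet> x) *\<^sub>R (dproj x h *v b) - ((H x *v h) \<bullet> x) *\<^sub>R (tproj x *v b))"
  by (simp add: N_def matrix_vector_mult_add_rdistrib matrix_vector_mult_diff_rdistrib
      matrix_add_rdistrib matrix_vector_mul_assoc matrix_mul_assoc flip: scaleR_matrix_vector_assoc)

lemma N_tangent:
  assumes x: "norm x = 1" and t: "x \<bullet> h = 0" "x \<bullet> a = 0" "x \<bullet> b = 0"
  shows "a \<bullet> (N x h *v b) = a \<bullet> (T x h *v b) - (h \<bullet> b) * (a \<bullet> (H x *v x))
    - (a \<bullet> h) * (x \<bullet> (H x *v b)) - (x \<bullet> (H x *v h)) * (a \<bullet> b)"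
proof -
  have p: "tproj x *v a = a" "tproj x *v b = b" using t by (auto simp: tproj_mult)
  have ap: "a \<bullet> (tproj x *v v) = a \<bullet> v" for v
    using tproj_inner[of a x v] p by (simp add: inner_commute)
  have ax: "a \<bullet> x = 0" using t by (simp add: inner_commute)
  show ?thesis
    unfolding N_mult p inner_add_right inner_diff_right ap
    using t ax by (simp add: dproj_mult matrix_vector_mult_scaleR inner_add_right inner_diff_right inner_commute[of _ x]
        matrix_vector_mult_minus_right)
qed

text \<open>This is the derivative of the identity \<open>W x *v x = 0\<close> along the
  sphere.\<close>

lemma N_self:
  assumes x: "norm x = 1" and h: "x \<bullet> h = 0"
  shows "N x h *v x = - (W x *v h)"
proof -
  have d: "dproj x h *v x = - h"
    using x h by (simp add: dproj_mult norm_eq_1 inner_commute)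
  have p: "tproj x *v h = h" using h by (simp add: tproj_mult)
  show ?thesis
    unfolding N_mult W_mult tproj_self[OF x] d p by (simp add: matrix_vector_mult_minus_right)
qed

text \<open>The ambient third derivative is totally symmetric, and so is the sum of the three
  corrections in \<open>N_tangent\<close>. Intrinsically, the covariant derivative of \<nabla>^2 u +
  u I is totally symmetric on the unit sphere.\<close>

lemma N_codazzi:
  assumes x: "norm x = 1" and t: "x \<bullet> h = 0" "x \<bullet> a = 0" "x \<bullet> b = 0"
  shows "b \<bullet> (N x h *v a) = a \<bullet> (N x b *v h)"
proof -
  have xS: "x \<in> S" using x by (rule in_S)
  have "b \<bullet> (T x h *v a) = a \<bullet> (T x b *v h)"
    using T_sym1[OF xS, of b h a] T_sym2[OF xS, of h b] by simp
  moreover have "b \<bullet> (H x *v x) = x \<bullet> (H x *v b)" "x \<bullet> (H x *v a) = a \<bullet> (H x *v x)"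
    using H_sym[OF xS] by auto
  ultimately show ?thesis
    unfolding N_tangent[OF x t(1,3,2)] N_tangent[OF x t(3,2,1)] by (simp add: inner_commute)
qed

lemma dG_circ:
  assumes "norm x = 1" "norm h = 1" "x \<bullet> h = 0"
  shows "((\<lambda>s. G (circ x h s)) has_vector_derivative W (circ x h s) *v circ' x h s) (at s)"
proof -
  obtain G' where "(G has_derivative G') (at (circ x h s))" "G' (circ' x h s) = W (circ x h s) *v circ' x h s"
    using dG[OF circ_on_sphere(1,2)[OF assms]] by blast
  then show ?thesis
    using has_vector_derivative_chain[OF _ has_vector_derivative_circ(1)] by metis
qed

lemma du_circ:
  assumes "norm x = 1" "norm h = 1" "x \<bullet> h = 0"
  shows "((\<lambda>s. u (circ x h s)) has_real_derivative G (circ x h s) \<bullet> circ' x h s) (at s)"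
  using has_vector_derivative_chain[OF du[OF in_S[OF circ_on_sphere(1)[OF assms]]] has_vector_derivative_circ(1)]
  unfolding G_inner_tangent[OF circ_on_sphere(2)[OF assms]]
  by (simp add: has_real_derivative_iff_has_vector_derivative)

lemma dW_circ:
  assumes "norm x = 1"
  shows "((\<lambda>s. W (circ x h s)) has_vector_derivative N x h) (at 0)"
  using has_vector_derivative_chain[of W _ "circ x h" 0, OF _ has_vector_derivative_circ(1)]
    dW[OF in_S[OF assms]] by simp

section \<open>First and second order conditions at maximum points\<close>

lemma max_point_u:
  assumes max: "\<And>y. norm y = 1 \<Longrightarrow> u y \<le> u x"
    and x: "norm x = 1" and h: "norm h = 1" "x \<bullet> h = 0"
  shows "G x \<bullet> h = 0" and "h \<bullet> (W x *v h) \<le> u x"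
proof -
  have a: "((\<lambda>s. u (circ x h s)) has_real_derivative G (circ x h s) \<bullet> circ' x h s) (at s)" for s
    by (rule du_circ[OF x h])
  have "((\<lambda>s. G (circ x h s) \<bullet> circ' x h s) has_vector_derivative
      G (circ x h 0) \<bullet> (- circ x h 0) + (W (circ x h 0) *v circ' x h 0) \<bullet> circ' x h 0) (at 0)"
    by (rule bounded_bilinear.has_vector_derivative[OF bounded_bilinear_inner dG_circ[OF x h] has_vector_derivative_circ(2)])
  then have b: "((\<lambda>s. G (circ x h s) \<bullet> circ' x h s) has_real_derivative h \<bullet> (W x *v h) - u x) (at 0)"
    by (simp add: has_real_derivative_iff_has_vector_derivative inner_G_self[OF x] inner_commute)
  have c: "u (circ x h s) \<le> u (circ x h 0)" for s
    using max[OF circ_on_sphere(1)[OF x h]] by simp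
  show "G x \<bullet> h = 0" "h \<bullet> (W x *v h) \<le> u x"
    using second_derivative_test[OF a b c] by simp_all
qed

text \<open>Instead of the quotient |G|^2 / u^2, the function |G|^2 - M u^2 is differentiated: it is
  at most 0 on the sphere and equals 0 at x.\<close>

lemma max_point_gradient:
  assumes max: "\<And>y. norm y = 1 \<Longrightarrow> (norm (G y))\<^sup>2 \<le> M * (u y)\<^sup>2" and eq: "(norm (G x))\<^sup>2 = M * (u x)\<^sup>2"
    and x: "norm x = 1" and h: "norm h = 1" "x \<bullet> h = 0"
  shows "G x \<bullet> (W x *v h) = M * u x * (G x \<bullet> h)"
    and "(norm (W x *v h))\<^sup>2 + G x \<bullet> (N x h *v h) - M * (G x \<bullet> h)\<^sup>2 - M * u x * (h \<bullet> (W x *v h))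
      + M * (u x)\<^sup>2 \<le> 0"
proof -
  define c c' where "c = circ x h" and "c' = circ' x h"
  have c0: "c 0 = x" "c' 0 = h" by (simp_all add: c_def c'_def)
  have dc: "(c' has_vector_derivative - c s) (at s)" for s
    unfolding c_def c'_def by (rule has_vector_derivative_circ)
  have dGc: "((\<lambda>s. G (c s)) has_vector_derivative W (c s) *v c' s) (at s)" for s
    unfolding c_def c'_def by (rule dG_circ[OF x h])
  have duc: "((\<lambda>s. u (c s)) has_real_derivative G (c s) \<bullet> c' s) (at s)" for s
    unfolding c_def c'_def by (rule du_circ[OF x h])
  have dWc: "((\<lambda>s. W (c s)) has_vector_derivative N x h) (at 0)"
    unfolding c_def by (rule dW_circ[OF x])
  define f where "f = (\<lambda>s. G (c s) \<bullet> G (c s) - M * (u (c s))\<^sup>2)"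
  define f' where "f' = (\<lambda>s. 2 * (G (c s) \<bullet> (W (c s) *v c' s)) - 2 * M * (u (c s) * (G (c s) \<bullet> c' s)))"
  have df: "(f has_real_derivative f' s) (at s)" for s
  proof -
    have "((\<lambda>s. G (c s) \<bullet> G (c s)) has_vector_derivative
        G (c s) \<bullet> (W (c s) *v c' s) + (W (c s) *v c' s) \<bullet> G (c s)) (at s)"
      by (rule bounded_bilinear.has_vector_derivative[OF bounded_bilinear_inner dGc dGc])
    then have "((\<lambda>s. G (c s) \<bullet> G (c s)) has_real_derivative 2 * (G (c s) \<bullet> (W (c s) *v c' s))) (at s)"
      by (simp add: has_real_derivative_iff_has_vector_derivative inner_commute)
    then show ?thesis
      unfolding f_def f'_def by (auto intro!: derivative_eq_intros duc)
  qed
  have dG': "((\<lambda>s. G (c s)) has_vector_derivative W x *v h) (at 0)"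
    using dGc[of 0] by (simp add: c0)
  have dWc': "((\<lambda>s. W (c s) *v c' s) has_vector_derivative N x h *v h) (at 0)"
  proof -
    have "((\<lambda>s. W (c s) *v c' s) has_vector_derivative W (c 0) *v (- c 0) + N x h *v c' 0) (at 0)"
      by (rule bounded_bilinear.has_vector_derivative[OF bounded_bilinear_matrix_vector_mult dWc dc])
    \<comment> \<open>The acceleration of the circle is normal, and \<open>W\<close> annihilates the
      normal.\<close>
    then show ?thesis by (simp add: c0 matrix_vector_mult_minus_right W_self[OF x])
  qed
  have d1: "((\<lambda>s. G (c s) \<bullet> (W (c s) *v c' s)) has_real_derivative
      G x \<bullet> (N x h *v h) + (W x *v h) \<bullet> (W x *v h)) (at 0)"
    using bounded_bilinear.has_vector_derivative[OF bounded_bilinear_inner dG' dWc']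
    by (simp add: has_real_derivative_iff_has_vector_derivative c0)
  have d2: "((\<lambda>s. G (c s) \<bullet> c' s) has_real_derivative h \<bullet> (W x *v h) - u x) (at 0)"
    using bounded_bilinear.has_vector_derivative[OF bounded_bilinear_inner dG' dc]
    by (simp add: has_real_derivative_iff_has_vector_derivative c0 inner_G_self[OF x] inner_commute)
  have d3: "((\<lambda>s. u (c s)) has_real_derivative G x \<bullet> h) (at 0)"
    using duc[of 0] by (simp add: c0)
  have df': "(f' has_real_derivative 2 * (G x \<bullet> (N x h *v h) + (W x *v h) \<bullet> (W x *v h))
      - 2 * M * ((G x \<bullet> h) * (G x \<bullet> h) + (h \<bullet> (W x *v h) - u x) * u x)) (at 0)"
    unfolding f'_def
    using DERIV_diff[OF DERIV_cmult[OF d1, of 2] DERIV_cmult[OF DERIV_mult[OF d3 d2], of "2 * M"]]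
    by (simp add: c0)
  have fmax: "f s \<le> f 0" for s
    using max[of "c s"] circ_on_sphere(1)[OF x h] eq
    by (simp add: f_def c0 c_def power2_norm_eq_inner)
  have "f' 0 = 0" by (rule second_derivative_test(1)[OF df df' fmax])
  then show "G x \<bullet> (W x *v h) = M * u x * (G x \<bullet> h)"
    by (simp add: f'_def c0)
  show "(norm (W x *v h))\<^sup>2 + G x \<bullet> (N x h *v h) - M * (G x \<bullet> h)\<^sup>2 - M * u x * (h \<bullet> (W x *v h))
      + M * (u x)\<^sup>2 \<le> 0"
    using second_derivative_test(2)[OF df df' fmax]
    unfolding power2_norm_eq_inner by (simp add: power2_eq_square algebra_simps)
qed

lemma N_sym:
  assumes x: "x \<in> S"
  shows "a \<bullet> (N x h *v b) = b \<bullet> (N x h *v a)"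
proof -
  have D: "((\<lambda>y. a \<bullet> (W y *v b)) has_derivative (\<lambda>h. a \<bullet> (N x h *v b))) (at x)" for a b
    by (intro has_derivative_inner_right dW x
        bounded_linear.has_derivative[OF bounded_bilinear.bounded_linear_left[OF bounded_bilinear_matrix_vector_mult]])
  have "((\<lambda>y. b \<bullet> (W y *v a)) has_derivative (\<lambda>h. a \<bullet> (N x h *v b))) (at x)"
    by (rule has_derivative_transform_within_open[OF D open_S x]) (rule W_sym)
  from has_derivative_unique[OF this D] show ?thesis by meson
qed

text \<open>The Codazzi symmetry exchanges differentiation along h for differentiation along the
  gradient, so that summation against the F_i yields the derivative of sigma_k along the gradient.
  The normal part u x of \<open>G\<close> gives the second term, through
  \<open>N_self\<close>.\<close>

lemma N_gradient:
  assumes x: "norm x = 1" and h: "x \<bullet> h = 0"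
  shows "G x \<bullet> (N x h *v h) = h \<bullet> (N x (sgrad g x) *v h) - u x * (h \<bullet> (W x *v h))"
proof -
  have t: "x \<bullet> sgrad g x = 0" using sgrad_inner_self[OF x] by (simp add: inner_commute)
  have 1: "sgrad g x \<bullet> (N x h *v h) = h \<bullet> (N x (sgrad g x) *v h)"
    by (rule N_codazzi[OF x h h t])
  have 2: "x \<bullet> (N x h *v h) = - (h \<bullet> (W x *v h))"
    using N_sym[OF in_S[OF x], of x h h] by (simp add: N_self[OF x h])
  show ?thesis
    by (simp add: G_def inner_add_left 1 2)
qed

text \<open>The first order condition makes the residual orthogonal to every unit tangent vector;
  being tangent itself, it can be tested against its own direction.\<close>

lemma gradient_eigenvector:
  assumes max: "\<And>y. norm y = 1 \<Longrightarrow> (norm (G y))\<^sup>2 \<le> M * (u y)\<^sup>2" and eq: "(norm (G x))\<^sup>2 = M * (u x)\<^sup>2"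
    and x: "norm x = 1"
  shows "W x *v sgrad g x = (M * u x) *\<^sub>R sgrad g x"
proof -
  define r where "r = W x *v sgrad g x - (M * u x) *\<^sub>R sgrad g x"
  have t: "x \<bullet> sgrad g x = 0" using sgrad_inner_self[OF x] by (simp add: inner_commute)
  have xr: "x \<bullet> r = 0"
    using W_sym[OF in_S[OF x], of x "sgrad g x"] by (simp add: r_def inner_diff_right t W_self[OF x])
  have "h \<bullet> r = 0" if h: "norm h = 1" "x \<bullet> h = 0" for h
  proof -
    have "G x \<bullet> (W x *v h) = h \<bullet> (W x *v sgrad g x)"
      using W_sym[OF in_S[OF x], of "G x" h]
      by (simp add: G_def matrix_vector_right_distrib matrix_vector_mult_scaleR W_self[OF x])
    moreover have "G x \<bullet> h = h \<bullet> sgrad g x"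
      using h by (simp add: G_def inner_add_left) (rule inner_commute)
    ultimately show ?thesis
      using max_point_gradient(1)[OF max eq x h] by (simp add: r_def inner_diff_right)
  qed
  from this[of "(1 / norm r) *\<^sub>R r"] have "r = 0"
    using xr by (cases "r = 0") auto
  then show ?thesis by (simp add: r_def)
qed

lemma N_scale: "x \<in> S \<Longrightarrow> N x (r *\<^sub>R h) = r *\<^sub>R N x h"
  using bounded_linear.linear[OF has_derivative_bounded_linear[OF dW]] by (rule linear_scale)

text \<open>The eigenbasis at x is frozen along the circle, so the matrix in this basis is diagonal
  at parameter 0, where the derivative is taken.\<close>

lemma has_real_derivative_pminors_W:
  fixes q :: "'m \<Rightarrow> real^'m"
  assumes x: "norm x = 1" and q: "\<And>i j. q i \<bullet> q j = (if i = j then 1 else 0)"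
    and eig: "\<And>i. W x *v q i = l i *\<^sub>R q i" and k: "Suc k \<le> CARD('m)"
  shows "((\<lambda>s. pminors (Suc k) (W (circ x h s))) has_real_derivative
    (\<Sum>i\<in>UNIV. (q i \<bullet> (N x h *v q i)) * elsym k (UNIV - {i}) l)) (at 0)"
proof -
  have d: "((\<lambda>s. (\<chi> i j. q i \<bullet> (W (circ x h s) *v q j)) $ i $ j) has_real_derivative q i \<bullet> (N x h *v q j)) (at 0)" for i j
    using bounded_linear.has_vector_derivative[OF bounded_linear_compose[OF bounded_linear_inner_right
          bounded_bilinear.bounded_linear_left[OF bounded_bilinear_matrix_vector_mult]] dW_circ[OF x]]
    by (simp add: has_real_derivative_iff_has_vector_derivative)
  have "((\<lambda>s. pminors (Suc k) (\<chi> i j. q i \<bullet> (W (circ x h s) *v q j))) has_real_derivative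
    (\<Sum>i\<in>UNIV. (q i \<bullet> (N x h *v q i)) *
      elsym k (UNIV - {i}) (\<lambda>i. (\<chi> i j. q i \<bullet> (W (circ x h 0) *v q j)) $ i $ i))) (at 0)"
    by (rule has_real_derivative_pminors[OF d]) (simp add: eig q)
  then show ?thesis
    using pminors_orthonormal_basis[OF q k] by (simp add: eig q)
qed

text \<open>\<open>i0\<close> and \<open>i1\<close> are the places of the normal and of the gradient
  direction in the eigenbasis. The second order conditions at the other indices are summed with
  weights F_i; the one at \<open>i1\<close> is added so that the derivative of sigma_k along the
  gradient is complete.\<close>

lemma gradient_inequality:
  assumes max: "\<And>y. norm y = 1 \<Longrightarrow> (norm (G y))\<^sup>2 \<le> M * (u y)\<^sup>2" and eq: "(norm (G x))\<^sup>2 = M * (u x)\<^sup>2"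
    and x: "norm x = 1" and u: "u x > 0" and nz: "sgrad g x \<noteq> 0"
    and k: "Suc k \<le> CARD('m)" and cone: "\<And>j. j \<le> Suc k \<Longrightarrow> 0 < pminors j (W x)"
    and equ: "\<And>y. norm y = 1 \<Longrightarrow>
      pminors (Suc k) (W y) = u y powr a * (norm (G y))\<^sup>2 powr b * \<phi> y"
    and ab: "real (Suc k) \<le> a + 2 * b"
    and d\<phi>: "(\<phi> has_derivative (\<lambda>h. g\<phi> x \<bullet> h)) (at x)" and \<phi>: "\<phi> x > 0"
    and ij: "i0 \<noteq> (i1 :: 'm)"
  shows "\<exists>l. l i0 = 0 \<and> l i1 = M * u x \<and> (\<forall>j\<le>CARD('m). pminors j (W x) = elsym j UNIV l) \<and>
    (\<Sum>i\<in>UNIV - {i0, i1}. elsym k (UNIV - {i}) l * ((l i - u x)\<^sup>2 + (M - 1) * (u x)\<^sup>2))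
      \<le> elsym (Suc k) UNIV l * norm (sgrad g x) * (norm (sgrad g\<phi> x) / \<phi> x)"
proof -
  have xS: "x \<in> S" using x by (rule in_S)
  define r where "r = norm (sgrad g x)"
  define e where "e = (1 / r) *\<^sub>R sgrad g x"
  have r: "r > 0" using nz by (simp add: r_def)
  have t: "x \<bullet> sgrad g x = 0" using sgrad_inner_self[OF x] by (simp add: inner_commute)
  have e: "norm e = 1" "x \<bullet> e = 0" and re: "sgrad g x = r *\<^sub>R e"
    using r t by (auto simp: e_def r_def)
  have ee: "e \<bullet> e = 1" using e by (simp add: norm_eq_1)
  have r2: "r\<^sup>2 = (M - 1) * (u x)\<^sup>2"
    using G_norm[OF x] eq by (simp add: r_def algebra_simps)
  then have M: "M > 1"
    using r u by (metis diff_gt_0_iff_gt zero_less_mult_pos2 zero_less_power)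
  have We: "W x *v e = (M * u x) *\<^sub>R e"
    using gradient_eigenvector[OF max eq x] by (simp add: e_def matrix_vector_mult_scaleR)
  obtain q l where q0: "\<And>i. i \<in> {i0, i1} \<Longrightarrow> q i = (if i = i0 then x else e)"
      "\<And>i. i \<in> {i0, i1} \<Longrightarrow> l i = (if i = i0 then 0 else M * u x)"
    and q: "\<And>i j. q i \<bullet> q j = (if i = j then 1 else 0)" and eig: "\<And>i. W x *v q i = l i *\<^sub>R q i"
  proof (rule orthonormal_eigenbasis_extend[OF W_transpose[OF xS], of "{i0, i1}" "\<lambda>i. if i = i0 then x else e"
      "\<lambda>i. if i = i0 then 0 else M * u x"])
    show "(if i = i0 then x else e) \<bullet> (if j = i0 then x else e) = (if i = j then 1 else 0)"
      if "i \<in> {i0, i1}" "j \<in> {i0, i1}" for i j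
      using that ij e ee x by (auto simp: norm_eq_1 inner_commute)
    show "W x *v (if i = i0 then x else e) = (if i = i0 then 0 else M * u x) *\<^sub>R (if i = i0 then x else e)" for i
      by (simp add: W_self[OF x] We)
  qed blast
  have qi: "q i0 = x" "q i1 = e" and li: "l i0 = 0" "l i1 = M * u x"
    using q0[of i0] q0[of i1] ij by auto
  have pm: "pminors j (W x) = elsym j UNIV l" if "j \<le> CARD('m)" for j
    using q eig that by (rule pminors_eigenbasis)
  have pc: "pos_cone (Suc k) UNIV l"
    unfolding pos_cone_def using cone pm k by (metis order_trans)
  define F where "F i = elsym k (UNIV - {i}) l" for i
  define E where "E = elsym (Suc k) UNIV l"
  have F: "F i > 0" for i
    using pos_cone_restrict[OF finite UNIV_I pc, of i] by (simp add: F_def pos_cone_def)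
  have E: "E > 0" using pc by (simp add: E_def pos_cone_def)
  define n where "n i = q i \<bullet> (N x e *v q i)" for i
  define Q where "Q i = (l i - u x)\<^sup>2 + (M - 1) * (u x)\<^sup>2" for i
  define J where "J = UNIV - {i0, i1}"
  have sumJ: "sum f UNIV = f i0 + f i1 + sum f J" for f :: "'m \<Rightarrow> real"
  proof -
    have "UNIV = insert i0 (insert i1 J)" by (auto simp: J_def)
    then have "sum f UNIV = sum f (insert i0 (insert i1 J))" by simp
    then show ?thesis using ij by (simp add: J_def)
  qed
  have Ge: "G x \<bullet> v = r * (e \<bullet> v)" if "x \<bullet> v = 0" for v
    using that by (simp add: G_def re inner_add_left)
  \<comment> \<open>The normal direction contributes nothing to the derivative of sigma_k, as
    \<open>N x e\<close> maps x to a multiple of e.\<close>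
  have n0: "n i0 = 0"
    using N_self[OF x e(2)] e(2) by (simp add: n_def qi We)
  have Bi: "(l i)\<^sup>2 + r * n i - u x * l i - M * (r * (e \<bullet> q i))\<^sup>2 - M * u x * l i + M * (u x)\<^sup>2 \<le> 0"
    if i: "i \<noteq> i0" for i
  proof -
    have xq: "x \<bullet> q i = 0" using q[of i0 i] i by (simp add: qi)
    have nq: "norm (q i) = 1" using q[of i i] by (simp add: norm_eq_1)
    have "G x \<bullet> (N x (q i) *v q i) = r * n i - u x * l i"
      unfolding N_gradient[OF x xq] using q[of i i]
      by (simp add: re N_scale[OF xS] n_def eig scaleR_matrix_vector_assoc[symmetric])
    then show ?thesis
      using max_point_gradient(2)[OF max eq x nq xq] q[of i i]
      by (simp add: eig Ge[OF xq] power_mult_distrib nq)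
  qed
  have eJ: "e \<bullet> q i = 0" if "i \<in> J" for i
    using q[of i1 i] that by (auto simp: J_def qi)
  have "(\<Sum>i\<in>J. F i * (Q i + r * n i + (1 - M) * u x * l i)) \<le> 0"
  proof (rule sum_nonpos)
    fix i assume i: "i \<in> J"
    then have "Q i + r * n i + (1 - M) * u x * l i \<le> 0"
      using Bi[of i] eJ[OF i] by (simp add: J_def Q_def power2_eq_square algebra_simps)
    then show "F i * (Q i + r * n i + (1 - M) * u x * l i) \<le> 0"
      using F[of i] by (simp add: mult_nonneg_nonpos)
  qed
  moreover have "(\<Sum>i\<in>J. F i * (Q i + r * n i + (1 - M) * u x * l i))
      = (\<Sum>i\<in>J. F i * Q i) + r * (\<Sum>i\<in>J. n i * F i) + (1 - M) * u x * (\<Sum>i\<in>J. l i * F i)"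
    unfolding sum_distrib_left sum.distrib[symmetric] by (intro sum.cong) (auto simp: algebra_simps)
  ultimately have s1: "(\<Sum>i\<in>J. F i * Q i) + r * (\<Sum>i\<in>J. n i * F i) + (1 - M) * u x * (\<Sum>i\<in>J. l i * F i) \<le> 0"
    by simp
  \<comment> \<open>Since l i1 = M u, all terms in u alone cancel in the second order condition
    along e.\<close>
  have "r * n i1 - M * r\<^sup>2 \<le> 0"
    using Bi[of i1] ij by (simp add: li qi ee power2_eq_square algebra_simps)
  then have s2: "F i1 * (r * n i1 - M * r\<^sup>2) \<le> 0"
    using F[of i1] by (simp add: mult_nonneg_nonpos)
  have s3: "M * u x * F i1 + (\<Sum>i\<in>J. l i * F i) = real (Suc k) * E"
    using elsym_euler[OF finite, of l k UNIV] sumJ[of "\<lambda>i. l i * F i"] by (simp add: F_def E_def li)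
  \<comment> \<open>The logarithmic derivative of the equation along e: u has derivative r, and
    |G|^2 = M u^2 has derivative 2 M u r, so both powers contribute multiples of r / u.\<close>
  have s4: "n i1 * F i1 + (\<Sum>i\<in>J. n i * F i) = E * ((a + 2 * b) * r / u x + (g\<phi> x \<bullet> e) / \<phi> x)"
  proof -
    have L: "((\<lambda>s. pminors (Suc k) (W (circ x e s))) has_real_derivative (\<Sum>i\<in>UNIV. n i * F i)) (at 0)"
      unfolding n_def F_def by (rule has_real_derivative_pminors_W[OF x q eig k])
    have du0: "((\<lambda>s. u (circ x e s)) has_real_derivative r) (at 0)"
      using du_circ[OF x e, of 0] by (simp add: Ge[OF e(2)] ee)
    have "((\<lambda>s. G (circ x e s) \<bullet> G (circ x e s)) has_vector_derivative
        G (circ x e 0) \<bullet> (W (circ x e 0) *v circ' x e 0) + (W (circ x e 0) *v circ' x e 0) \<bullet> G (circ x e 0)) (at 0)"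
      by (rule bounded_bilinear.has_vector_derivative[OF bounded_bilinear_inner dG_circ[OF x e] dG_circ[OF x e]])
    moreover have "G x \<bullet> e = r" "e \<bullet> G x = r"
      using Ge[OF e(2)] ee by (simp_all add: inner_commute)
    ultimately have dG0: "((\<lambda>s. (norm (G (circ x e s)))\<^sup>2) has_real_derivative 2 * M * u x * r) (at 0)"
      by (simp add: has_real_derivative_iff_has_vector_derivative We power2_norm_eq_inner mult_ac)
    have d\<phi>0: "((\<lambda>s. \<phi> (circ x e s)) has_real_derivative g\<phi> x \<bullet> e) (at 0)"
      using has_vector_derivative_chain[of \<phi> _ "circ x e" 0, OF _ has_vector_derivative_circ(1)] d\<phi>
      by (simp add: has_real_derivative_iff_has_vector_derivative)
    have G0: "(norm (G x))\<^sup>2 > 0" using eq M u by simp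
    have P1: "((\<lambda>s. u (circ x e s) powr a) has_real_derivative u x powr a * (a * r / u x)) (at 0)"
      using DERIV_powr[OF du0 _ DERIV_const, of a] u by (simp add: mult_ac)
    have P2: "((\<lambda>s. (norm (G (circ x e s)))\<^sup>2 powr b) has_real_derivative
        (norm (G x))\<^sup>2 powr b * (2 * b * r / u x)) (at 0)"
    proof -
      have "2 * M * u x * r * b / (norm (G x))\<^sup>2 = 2 * b * r / u x"
        unfolding eq using M u by (simp add: field_simps power2_eq_square)
      then show ?thesis
        using DERIV_powr[OF dG0 _ DERIV_const, of b] G0 by simp
    qed
    have R: "((\<lambda>s. u (circ x e s) powr a * (norm (G (circ x e s)))\<^sup>2 powr b * \<phi> (circ x e s)) has_real_derivative
        u x powr a * (norm (G x))\<^sup>2 powr b * \<phi> x * ((a + 2 * b) * r / u x + (g\<phi> x \<bullet> e) / \<phi> x)) (at 0)"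
      by (rule DERIV_cong[OF DERIV_mult[OF DERIV_mult[OF P1 P2] d\<phi>0]])
        (use \<phi> u in \<open>simp add: field_simps\<close>)
    have "(\<lambda>s. pminors (Suc k) (W (circ x e s)))
       = (\<lambda>s. u (circ x e s) powr a * (norm (G (circ x e s)))\<^sup>2 powr b * \<phi> (circ x e s))"
      using equ[OF circ_on_sphere(1)[OF x e]] by simp
    from DERIV_unique[OF L[unfolded this] R]
    have "(\<Sum>i\<in>UNIV. n i * F i) = E * ((a + 2 * b) * r / u x + (g\<phi> x \<bullet> e) / \<phi> x)"
      using equ[OF x] pm[OF k] by (simp add: E_def)
    then show ?thesis using sumJ[of "\<lambda>i. n i * F i"] n0 by simp
  qed
  have \<phi>e: "- (g\<phi> x \<bullet> e) \<le> norm (sgrad g\<phi> x)"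
  proof -
    have "g\<phi> x \<bullet> e = sgrad g\<phi> x \<bullet> e" using e by (simp add: sgrad_def inner_diff_left)
    then show ?thesis
      using Cauchy_Schwarz_ineq2[of "sgrad g\<phi> x" e] e by simp
  qed
  have final: "(\<Sum>i\<in>J. F i * Q i) \<le> E * r * (norm (sgrad g\<phi> x) / \<phi> x)"
  proof -
    define X Y Z where "X = (\<Sum>i\<in>J. F i * Q i)" and "Y = (\<Sum>i\<in>J. n i * F i)"
      and "Z = (\<Sum>i\<in>J. l i * F i)"
    define v d where "v = u x" and "d = (g\<phi> x \<bullet> e) / \<phi> x"
    have Z: "Z = real (Suc k) * E - M * v * F i1" using s3 by (simp add: Z_def v_def)
    have Y: "Y = E * ((a + 2 * b) * r / v + d) - n i1 * F i1" using s4 by (simp add: Y_def v_def d_def)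
    \<comment> \<open>After inserting the differentiated equation for Y and Euler's identity for Z,
      F_i1 is left with the factor (M - 1) v^2 - r^2, which vanishes.\<close>
    have "X + r * Y + (1 - M) * v * Z + F i1 * (r * n i1 - M * r\<^sup>2) \<le> 0"
      using s1 s2 by (simp add: X_def Y_def Z_def v_def)
    also have "X + r * Y + (1 - M) * v * Z + F i1 * (r * n i1 - M * r\<^sup>2)
        = X + E * ((a + 2 * b) * (r\<^sup>2 / v)) + E * r * d + (1 - M) * v * real (Suc k) * E
          + M * F i1 * ((M - 1) * v\<^sup>2 - r\<^sup>2)"
      unfolding Y Z by (simp add: algebra_simps power2_eq_square add_divide_distrib)
    also have "\<dots> = X + (a + 2 * b - real (Suc k)) * ((M - 1) * v * E) + E * r * d"
    proof -
      have rv: "r\<^sup>2 / v = (M - 1) * v" using u r2 by (simp add: v_def power2_eq_square)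
      have rr: "(M - 1) * v\<^sup>2 - r\<^sup>2 = 0" using r2 by (simp add: v_def)
      show ?thesis unfolding rv rr by (simp add: algebra_simps)
    qed
    finally have "X \<le> - (E * r * d) - (a + 2 * b - real (Suc k)) * ((M - 1) * v * E)"
      by simp
    \<comment> \<open>By \<open>ab\<close> the right side of the equation has total degree at least
      \<open>Suc k\<close>, which gives the discarded term its sign.\<close>
    also have "\<dots> \<le> - (E * r * d)"
      using ab M u E by (simp add: v_def)
    also have "\<dots> \<le> E * r * (norm (sgrad g\<phi> x) / \<phi> x)"
    proof -
      have "- d \<le> norm (sgrad g\<phi> x) / \<phi> x"
        using \<phi>e \<phi> unfolding d_def by (simp add: divide_simps)
      then have "E * r * (- d) \<le> E * r * (norm (sgrad g\<phi> x) / \<phi> x)"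
        using E r by (intro mult_left_mono) auto
      then show ?thesis by simp
    qed
    finally show ?thesis by (simp add: X_def)
  qed
  then show ?thesis
    using li pm unfolding F_def Q_def J_def E_def r_def by blast
qed

end

section \<open>From pointwise inequalities to bounds on the whole sphere\<close>

lemma circ_joins:
  fixes x y :: "'a::euclidean_space"
  assumes "norm x = 1" "norm y = 1" "2 \<le> DIM('a)"
  obtains h \<theta> where "norm h = 1" "x \<bullet> h = 0" "0 \<le> \<theta>" "\<theta> \<le> pi" "circ x h \<theta> = y"
proof -
  define w where "w = y - (x \<bullet> y) *\<^sub>R x"
  have xx: "x \<bullet> x = 1" "y \<bullet> y = 1" using assms by (auto simp: norm_eq_1)
  have xw: "x \<bullet> w = 0" by (simp add: w_def inner_diff_right xx)
  have "w \<bullet> w = 1 - (x \<bullet> y)\<^sup>2"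
    by (simp add: w_def inner_diff_left inner_diff_right xx power2_eq_square inner_commute[of y x])
  then have nw: "norm w = sqrt (1 - (x \<bullet> y)\<^sup>2)"
    by (simp add: norm_eq_sqrt_inner)
  obtain h where h: "norm h = 1" "x \<bullet> h = 0" "norm w *\<^sub>R h = w"
  \<comment> \<open>The case w = 0 means y = x or y = - x, where any direction orthogonal to x
    serves.\<close>
  proof (cases "w = 0")
    case True
    obtain z where "z \<noteq> 0" "orthogonal x z"
      using orthogonal_to_vector_exists[OF assms(3)] by metis
    then show ?thesis
      using that[of "(1 / norm z) *\<^sub>R z"] True by (simp add: orthogonal_def)
  next
    case False
    then show ?thesis using that[of "(1 / norm w) *\<^sub>R w"] xw by simp
  qed
  have c: "\<bar>x \<bullet> y\<bar> \<le> 1" using Cauchy_Schwarz_ineq2[of x y] assms by simp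
  have "circ x h (arccos (x \<bullet> y)) = (x \<bullet> y) *\<^sub>R x + norm w *\<^sub>R h"
    using c by (simp add: circ_def nw sin_arccos_abs cos_arccos_abs)
  also have "\<dots> = y" using h by (simp add: w_def)
  finally show ?thesis
    using that[of h "arccos (x \<bullet> y)"] h c arccos_bounded[of "x \<bullet> y"] by (auto simp: abs_le_iff)
qed

lemma pminors_0 [simp]:
  fixes A :: "real^'n^'n"
  shows "pminors 0 A = 1"
proof -
  have "{S :: 'n set. card S = 0} = {{}}" by auto
  then show ?thesis
    unfolding pminors_def by simp
qed

lemma power2_powr_half: "0 < x \<Longrightarrow> x\<^sup>2 powr (b / 2) = x powr b" for x b :: real
  using powr_powr[of x 2 "b / 2"] by simp

context sphere_fun
begin

lemma continuous_on_u: "continuous_on (sphere 0 1) u"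
  by (intro continuous_at_imp_continuous_on ballI has_derivative_continuous[OF du[OF in_S]]) simp

lemma continuous_on_G: "continuous_on (sphere 0 1) G"
proof -
  have "continuous_on (sphere 0 1) g"
    by (intro continuous_at_imp_continuous_on ballI has_derivative_continuous[OF dg[OF in_S]]) simp
  then show ?thesis
    unfolding G_def[abs_def] sgrad_def by (intro continuous_intros continuous_on_u)
qed

lemma tangent_unit_zero:
  assumes "norm x = 1" "\<And>h. norm h = 1 \<Longrightarrow> x \<bullet> h = 0 \<Longrightarrow> G x \<bullet> h = 0"
  shows "sgrad g x = 0"
proof (rule ccontr)
  assume nz: "sgrad g x \<noteq> 0"
  define h where "h = (1 / norm (sgrad g x)) *\<^sub>R sgrad g x"
  have t: "x \<bullet> sgrad g x = 0" using sgrad_inner_self[OF assms(1)] by (simp add: inner_commute)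
  then have "norm h = 1" "x \<bullet> h = 0" using nz by (auto simp: h_def)
  from assms(2)[OF this] nz t show False
    by (simp add: h_def G_def inner_add_left)
qed

text \<open>All eigenvalues are at most u at the maximum, and the positive trace then bounds each of
  them from below. With absolute values controlled, a crude count of the at most 2^N products
  suffices, N being the ambient dimension.\<close>

lemma max_point_pminors:
  assumes max: "\<And>y. norm y = 1 \<Longrightarrow> u y \<le> u x" and x: "norm x = 1" and u: "u x > 0"
    and k: "Suc k \<le> CARD('m)" and cone: "0 < pminors 1 (W x)"
  shows "sgrad g x = 0" and "pminors (Suc k) (W x) \<le> 2 ^ CARD('m) * (CARD('m) * u x) ^ Suc k"
proof -
  show "sgrad g x = 0"
    using x max_point_u(1)[OF max x] by (rule tangent_unit_zero)
  obtain i0 :: 'm where True by blast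
  obtain q l where q0: "\<And>i. i \<in> {i0} \<Longrightarrow> q i = x" "\<And>i. i \<in> {i0} \<Longrightarrow> l i = 0"
    and q: "\<And>i j. q i \<bullet> q j = (if i = j then 1 else 0)" and eig: "\<And>i. W x *v q i = l i *\<^sub>R q i"
  proof (rule orthonormal_eigenbasis_extend[OF W_transpose[OF in_S[OF x]], of "{i0}" "\<lambda>_. x" "\<lambda>_. 0"])
    show "x \<bullet> x = (if i = j then 1 else 0)" if "i \<in> {i0}" "j \<in> {i0}" for i j
      using that x by (auto simp: norm_eq_1)
    show "W x *v x = 0 *\<^sub>R x" by (simp add: W_self[OF x])
  qed blast
  have le: "l i \<le> u x" for i
  proof (cases "i = i0")
    case True
    then show ?thesis using q0 u by simp
  next
    case False
    have "norm (q i) = 1" "x \<bullet> q i = 0"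
      using q[of i i] q[of i0 i] q0 False by (auto simp: norm_eq_1)
    from max_point_u(2)[OF max x this] show ?thesis
      using q[of i i] by (simp add: eig)
  qed
  have pm: "pminors j (W x) = elsym j UNIV l" if "j \<le> CARD('m)" for j
    using q eig that by (rule pminors_eigenbasis)
  have sum: "0 < sum l UNIV"
    using cone pm[of 1] k by (simp add: elsym_1)
  have "\<bar>l i\<bar> \<le> CARD('m) * u x" for i
  proof -
    have "sum l UNIV = l i + sum l (UNIV - {i})" by (simp add: sum.remove)
    also have "\<dots> \<le> l i + real (card (UNIV - {i})) * u x"
      using sum_bounded_above[of "UNIV - {i}" l "u x"] le by simp
    finally have "- l i \<le> (real CARD('m) - 1) * u x"
      using sum by (simp add: card_Diff_singleton of_nat_diff)
    moreover have "1 * u x \<le> CARD('m) * u x" using u by (intro mult_right_mono) auto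
    ultimately show ?thesis using le[of i] u unfolding abs_le_iff left_diff_distrib by linarith
  qed
  then have "\<bar>elsym (Suc k) UNIV l\<bar> \<le> 2 ^ CARD('m) * (CARD('m) * u x) ^ Suc k"
    using u by (intro elsym_abs_le) auto
  then show "pminors (Suc k) (W x) \<le> 2 ^ CARD('m) * (CARD('m) * u x) ^ Suc k"
    using pm[OF k] by simp
qed

text \<open>Origin of the constant, with N the ambient dimension: 2^N N^(k+1) bounds sigma_(k+1) at
  the maximum of u, division by m makes it a bound of u^\<epsilon>, K bounds \<phi>, and 2^(k+1)
  comes from 1 + t^2 <= (2 t)^2. The ratio K / m bounds |\<nabla>\<phi>| / \<phi>, and the outer
  maximum covers t < 1.\<close>

lemma gradient_bound:
  assumes card: "Suc k \<le> CARD('m) - 1" "2 \<le> CARD('m)"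
    and upos: "\<And>y. norm y = 1 \<Longrightarrow> u y > 0"
    and cone: "\<And>y j. norm y = 1 \<Longrightarrow> j \<le> Suc k \<Longrightarrow> 0 < pminors j (W y)"
    and equ: "\<And>y. norm y = 1 \<Longrightarrow> pminors (Suc k) (W y)
      = u y powr (p - 1 + \<epsilon>) * (norm (G y))\<^sup>2 powr ((real (Suc k) + 1 - p) / 2) * \<phi> y"
    and p: "p > 1" and \<epsilon>: "\<epsilon> > 0"
    and d\<phi>: "\<And>y. norm y = 1 \<Longrightarrow> (\<phi> has_derivative (\<lambda>h. g\<phi> y \<bullet> h)) (at y)"
    and m: "m > 0" and \<phi>: "\<And>y. norm y = 1 \<Longrightarrow> m \<le> \<phi> y" "\<And>y. norm y = 1 \<Longrightarrow> \<phi> y \<le> K"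
    and g\<phi>: "\<And>y. norm y = 1 \<Longrightarrow> norm (sgrad g\<phi> y) \<le> K"
    and y: "norm y = 1"
  shows "norm (sgrad g y) / u y \<le> max 1 ((real (Suc k) + 3 * (K / m)) ^ Suc k *
    ((2 :: real) ^ CARD('m) * real CARD('m) ^ Suc k * K / m * 2 ^ Suc k))"
proof -
  have k: "Suc k \<le> CARD('m)" using card by simp
  define C1 where "C1 = (2 :: real) ^ CARD('m) * real CARD('m) ^ Suc k"
  define D where "D = C1 * K / m * 2 ^ Suc k"
  have "y \<in> sphere 0 1" using y by simp
  then have "sphere (0 :: real^'m) 1 \<noteq> {}" by (metis empty_iff)
  note sph = this compact_sphere[of "0 :: real^'m" 1]
  have K: "0 < K" using m \<phi>[OF y] by linarith
  have C1: "0 < C1" by (simp add: C1_def)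

  obtain x1 where x1: "norm x1 = 1" "\<And>y. norm y = 1 \<Longrightarrow> u y \<le> u x1"
    using continuous_attains_sup[OF sph(2,1) continuous_on_u] by (auto simp: Ball_def)
  \<comment> \<open>The exponents of u add up to \<open>Suc k\<close> + \<epsilon>; the factor
    \<open>u x ^ Suc k\<close> will cancel against the homogeneity of the minors.\<close>
  have powers: "u x powr (p - 1 + \<epsilon>) * (v * (u x)\<^sup>2) powr ((real (Suc k) + 1 - p) / 2)
      = u x ^ Suc k * u x powr \<epsilon> * v powr ((real (Suc k) + 1 - p) / 2)"
    if "norm x = 1" "v > 0" for x v
  proof -
    have u: "u x > 0" using that upos by blast
    have "(u x)\<^sup>2 powr ((real (Suc k) + 1 - p) / 2) = u x powr (real (Suc k) + 1 - p)"
      using u by (rule power2_powr_half)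
    then have "u x powr (p - 1 + \<epsilon>) * (v * (u x)\<^sup>2) powr ((real (Suc k) + 1 - p) / 2)
      = (u x powr (p - 1 + \<epsilon>) * u x powr (real (Suc k) + 1 - p)) * v powr ((real (Suc k) + 1 - p) / 2)"
      using u that(2) by (simp add: powr_mult mult_ac del: of_nat_Suc)
    also have "u x powr (p - 1 + \<epsilon>) * u x powr (real (Suc k) + 1 - p) = u x powr (real (Suc k) + \<epsilon>)"
      by (simp add: powr_add[symmetric] algebra_simps)
    also have "\<dots> = u x ^ Suc k * u x powr \<epsilon>"
      using u by (simp only: powr_add powr_realpow)
    finally show ?thesis .
  qed
  \<comment> \<open>At the maximum point the gradient vanishes, so v = 1 in \<open>powers\<close>;
    as \<epsilon> > 0, the bound there passes to all points.\<close>
  have ueps: "u x powr \<epsilon> \<le> C1 / m" if x: "norm x = 1" for x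
  proof -
    have u1: "u x1 > 0" using x1 upos by blast
    have sg: "sgrad g x1 = 0"
      by (rule max_point_pminors(1)[OF x1(2,1) u1 k cone[OF x1(1)]]) simp_all
    have "pminors (Suc k) (W x1) \<le> 2 ^ CARD('m) * (CARD('m) * u x1) ^ Suc k"
      by (rule max_point_pminors(2)[OF x1(2,1) u1 k cone[OF x1(1)]]) simp_all
    also have "\<dots> = u x1 ^ Suc k * C1" by (simp add: C1_def power_mult_distrib)
    finally have "u x1 ^ Suc k * (u x1 powr \<epsilon> * \<phi> x1) \<le> u x1 ^ Suc k * C1"
      using equ[OF x1(1)] G_norm[OF x1(1)] powers[OF x1(1), of 1] by (simp add: sg mult_ac)
    then have 1: "u x1 powr \<epsilon> * \<phi> x1 \<le> C1" using u1 by (simp del: power_Suc)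
    have "u x powr \<epsilon> * m \<le> u x1 powr \<epsilon> * \<phi> x1"
      using x1(2)[OF x] upos[OF x] \<phi>(1)[OF x1(1)] m \<epsilon> by (intro mult_mono powr_mono2) auto
    with 1 show ?thesis using m by (simp add: pos_le_divide_eq)
  qed

  have "continuous_on (sphere 0 1) (\<lambda>x. (norm (G x))\<^sup>2 / (u x)\<^sup>2)"
    using upos by (intro continuous_intros continuous_on_G continuous_on_u) force
  from continuous_attains_sup[OF sph(2,1) this] obtain x where x: "norm x = 1"
    and xmax: "\<And>y. norm y = 1 \<Longrightarrow> (norm (G y))\<^sup>2 / (u y)\<^sup>2 \<le> (norm (G x))\<^sup>2 / (u x)\<^sup>2"
    by (auto simp: Ball_def)
  define M where "M = (norm (G x))\<^sup>2 / (u x)\<^sup>2"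
  have ux: "u x > 0" using x upos by blast
  have M1: "(norm (G y))\<^sup>2 \<le> M * (u y)\<^sup>2" if "norm y = 1" for y
    using xmax[OF that] upos[OF that] by (simp add: M_def pos_divide_le_eq)
  have M2: "(norm (G x))\<^sup>2 = M * (u x)\<^sup>2" using ux by (simp add: M_def)
  have "(u x)\<^sup>2 \<le> M * (u x)\<^sup>2" using G_norm[OF x] M2 by simp
  then have M: "M \<ge> 1" using ux by simp
  \<comment> \<open>t is the maximum of |\<nabla>u| / u.\<close>
  define t where "t = sqrt (M - 1)"
  have t2: "t\<^sup>2 = M - 1" and t0: "t \<ge> 0" using M by (auto simp: t_def)
  have bound: "norm (sgrad g y) / u y \<le> t" if y: "norm y = 1" for y
  proof -
    have "(norm (sgrad g y))\<^sup>2 \<le> (t * u y)\<^sup>2"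
      using M1[OF y] G_norm[OF y] by (simp add: power_mult_distrib t2 algebra_simps)
    moreover have "0 \<le> t * u y" using t0 upos[OF y] by simp
    ultimately have "norm (sgrad g y) \<le> t * u y" by (rule power2_le_imp_le)
    then show ?thesis using upos[OF y] by (simp add: pos_divide_le_eq)
  qed
  have "t \<le> (real (Suc k) + 3 * (K / m)) ^ Suc k * D" if t1: "t \<ge> 1"
  proof -
    have sg2: "(norm (sgrad g x))\<^sup>2 = (t * u x)\<^sup>2"
      using G_norm[OF x] M2 by (simp add: power_mult_distrib t2 algebra_simps)
    then have sg: "norm (sgrad g x) = t * u x"
      using t0 ux by (simp add: power2_eq_iff_nonneg)
    then have nz: "sgrad g x \<noteq> 0" using t1 ux by auto
    obtain i0 :: 'm where True by blast
    have "\<exists>i1. i0 \<noteq> i1"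
    proof (rule ccontr)
      assume "\<not> ?thesis"
      then have "UNIV = {i0}" by auto
      from arg_cong[OF this, of card] show False using card(2) by simp
    qed
    then obtain i1 where ij: "i0 \<noteq> i1" by blast
    have \<phi>x: "\<phi> x > 0" using \<phi>(1)[OF x] m by simp
    have ab: "real (Suc k) \<le> (p - 1 + \<epsilon>) + 2 * ((real (Suc k) + 1 - p) / 2)"
    proof -
      have half: "2 * (y / 2) = y" for y :: real by simp
      show ?thesis unfolding half using \<epsilon> by simp
    qed
    obtain l where l: "l i0 = 0" "l i1 = M * u x" "\<And>j. j \<le> CARD('m) \<Longrightarrow> pminors j (W x) = elsym j UNIV l"
      "(\<Sum>i\<in>UNIV - {i0, i1}. elsym k (UNIV - {i}) l * ((l i - u x)\<^sup>2 + (M - 1) * (u x)\<^sup>2))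
      \<le> elsym (Suc k) UNIV l * norm (sgrad g x) * (norm (sgrad g\<phi> x) / \<phi> x)"
      using gradient_inequality[where \<phi> = \<phi> and g\<phi> = g\<phi> and a = "p - 1 + \<epsilon>" and
          b = "(real (Suc k) + 1 - p) / 2", OF M1 M2 x ux nz k cone[OF x] equ ab d\<phi>[OF x] \<phi>x ij] by blast
    \<comment> \<open>Division by u removes the scale of the solution, and omission of
      \<open>i0\<close> removes the eigenvalue 0 of the normal.\<close>
    define A where "A i = l i / u x" for i
    define I where "I = UNIV - {i0}"
    have drop: "elsym j (insert i0 X) l = u x ^ j * elsym j X A" if "i0 \<notin> X" for j X
    proof -
      have "elsym j (insert i0 X) l = elsym j X l"
        using that l(1) by (cases j) (auto simp: elsym_insert)
      also have "\<dots> = elsym j X (\<lambda>i. u x * A i)"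
        using ux by (simp add: A_def)
      finally show ?thesis by (simp only: elsym_scale)
    qed
    have ins: "UNIV = insert i0 I" by (auto simp: I_def)
    have drop_I: "elsym j UNIV l = u x ^ j * elsym j I A" for j
      unfolding ins by (rule drop) (simp add: I_def)
    have drop_Ii: "elsym j (UNIV - {i}) l = u x ^ j * elsym j (I - {i}) A" if "i \<noteq> i0" for j i
    proof -
      have "UNIV - {i} = insert i0 (I - {i})" using that by (auto simp: I_def)
      then show ?thesis using drop[of "I - {i}" j] by (simp add: I_def)
    qed
    show ?thesis
    proof (rule elsym_gradient_bound[of I i1])
      show "finite I" "i1 \<in> I" "Suc k \<le> card I"
        using ij card by (auto simp: I_def card_Diff_singleton)
      show "pos_cone (Suc k) I A"
        unfolding pos_cone_def
      proof (intro allI impI)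
        fix j assume j: "j \<le> Suc k"
        have "0 < u x ^ j * elsym j I A"
          using cone[OF x j] l(3)[of j] j k by (simp add: drop_I)
        then show "0 < elsym j I A" using ux by (simp add: zero_less_mult_iff)
      qed
      show "A i1 = 1 + t\<^sup>2" using ux by (simp add: A_def l(2) t2)
      show "0 \<le> K / m" using K m by simp
      show "elsym (Suc k) I A \<le> D * t ^ Suc k"
      proof -
        have "u x ^ Suc k * elsym (Suc k) I A
            = u x ^ Suc k * (u x powr \<epsilon> * M powr ((real (Suc k) + 1 - p) / 2) * \<phi> x)"
          using equ[OF x] powers[OF x, of M] M l(3)[OF k] by (simp add: M2 drop_I mult_ac)
        then have "elsym (Suc k) I A = u x powr \<epsilon> * M powr ((real (Suc k) + 1 - p) / 2) * \<phi> x"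
          using ux by simp
        also have "\<dots> \<le> (C1 / m) * (2 * t) ^ Suc k * K"
        proof (intro mult_mono)
          \<comment> \<open>As p > 1 and M >= 1, the exponent may be raised to half the order of
            sigma; this makes the bound independent of p.\<close>
          have "M powr ((real (Suc k) + 1 - p) / 2) \<le> M powr (real (Suc k) / 2)"
            using M p by (intro powr_mono) auto
          also have "\<dots> \<le> ((2 * t)\<^sup>2) powr (real (Suc k) / 2)"
          proof (rule powr_mono2)
            have "1 \<le> t\<^sup>2" using t1 by simp
            then show "M \<le> (2 * t)\<^sup>2" using t2 by (simp add: power_mult_distrib)
          qed (use M in auto)
          also have "((2 * t)\<^sup>2) powr (real (Suc k) / 2) = (2 * t) powr (real (Suc k))"
            using t1 by (intro power2_powr_half) simp
          also have "\<dots> = (2 * t) ^ Suc k" using t1 by (intro powr_realpow) simp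
          finally show "M powr ((real (Suc k) + 1 - p) / 2) \<le> (2 * t) ^ Suc k" .
        qed (use ueps[OF x] \<phi>[OF x] m C1 t1 in auto)
        also have "\<dots> = D * t ^ Suc k"
          by (simp add: D_def power_mult_distrib)
        finally show ?thesis .
      qed
      define s where "s = (\<Sum>i\<in>I - {i1}. elsym k (I - {i}) A * ((A i - 1)\<^sup>2 + t\<^sup>2))"
      \<comment> \<open>Powers of u: k from the partial derivative and 2 from the quadratic
        factor.\<close>
      have "u x ^ Suc (Suc k) * s = (\<Sum>i\<in>UNIV - {i0, i1}. elsym k (UNIV - {i}) l * ((l i - u x)\<^sup>2 + (M - 1) * (u x)\<^sup>2))"
        unfolding s_def sum_distrib_left
      proof (rule sum.cong)
        fix i assume "i \<in> UNIV - {i0, i1}"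
        then have "i \<noteq> i0" by simp
        moreover have "(l i - u x)\<^sup>2 + (M - 1) * (u x)\<^sup>2 = (u x)\<^sup>2 * ((A i - 1)\<^sup>2 + t\<^sup>2)"
        proof -
          have "l i = u x * A i" using ux by (simp add: A_def)
          then show ?thesis unfolding t2[symmetric] by (simp add: power2_eq_square algebra_simps)
        qed
        ultimately show "u x ^ Suc (Suc k) * (elsym k (I - {i}) A * ((A i - 1)\<^sup>2 + t\<^sup>2))
            = elsym k (UNIV - {i}) l * ((l i - u x)\<^sup>2 + (M - 1) * (u x)\<^sup>2)"
          by (simp add: drop_Ii power2_eq_square mult_ac)
      qed (auto simp: I_def)
      also have "\<dots> \<le> (u x ^ Suc k * elsym (Suc k) I A) * (t * u x) * (norm (sgrad g\<phi> x) / \<phi> x)"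
        using l(4) by (simp only: drop_I sg)
      also have "\<dots> \<le> (u x ^ Suc k * elsym (Suc k) I A) * (t * u x) * (K / m)"
      proof (rule mult_left_mono)
        show "norm (sgrad g\<phi> x) / \<phi> x \<le> K / m"
          using \<phi>(1)[OF x] g\<phi>[OF x] m K by (intro frac_le) auto
        have "0 < u x ^ Suc k * elsym (Suc k) I A"
          using cone[OF x order_refl] l(3)[OF k] by (simp add: drop_I)
        then show "0 \<le> (u x ^ Suc k * elsym (Suc k) I A) * (t * u x)"
          using t0 ux by simp
      qed
      also have "\<dots> = u x ^ Suc (Suc k) * (K / m * t * elsym (Suc k) I A)" by simp
      finally have "s \<le> K / m * t * elsym (Suc k) I A"
        by (rule mult_left_le_imp_le) (use ux in simp)
      then show "(\<Sum>i\<in>I - {i1}. elsym k (I - {i}) A * ((A i - 1)\<^sup>2 + t\<^sup>2)) \<le> K / m * t * elsym (Suc k) I A"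
        by (simp add: s_def)
    qed (use t1 in simp)
  qed
  then have "t \<le> max 1 ((real (Suc k) + 3 * (K / m)) ^ Suc k * D)" by linarith
  then show ?thesis
    using bound[OF y] unfolding D_def C1_def by linarith
qed

text \<open>Along a great circle the derivative of ln u is at most |\<nabla>u| / u, and two points
  are joined by an arc of length at most pi.\<close>

lemma harnack:
  assumes card: "2 \<le> CARD('m)" and upos: "\<And>y. norm y = 1 \<Longrightarrow> u y > 0" and C: "C \<ge> 0"
    and bound: "\<And>y. norm y = 1 \<Longrightarrow> norm (sgrad g y) / u y \<le> C"
    and x: "norm x = 1" and y: "norm y = 1"
  shows "u y / u x \<le> exp (C * pi)"
proof -
  obtain h \<theta> where h: "norm h = 1" "x \<bullet> h = 0" and \<theta>: "0 \<le> \<theta>" "\<theta> \<le> pi" "circ x h \<theta> = y"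
    using circ_joins[OF x y] card by auto
  define f where "f s = ln (u (circ x h s)) - C * s" for s
  have "f \<theta> \<le> f 0"
  proof (rule DERIV_nonpos_imp_nonincreasing[OF \<theta>(1)])
    fix s
    let ?c = "circ x h s" and ?c' = "circ' x h s"
    note c = circ_on_sphere[OF x h, of s]
    have uc: "u ?c > 0" using c upos by blast
    have d: "(f has_real_derivative (G ?c \<bullet> ?c') / u ?c - C) (at s)"
      unfolding f_def by (auto intro!: derivative_eq_intros du_circ[OF x h] uc)
    have "G ?c \<bullet> ?c' = sgrad g ?c \<bullet> ?c'" using c by (simp add: G_def inner_add_left)
    also have "\<dots> \<le> norm (sgrad g ?c)"
      using Cauchy_Schwarz_ineq2[of "sgrad g ?c" ?c'] c by simp
    also have "\<dots> \<le> C * u ?c" using bound[OF c(1)] uc by (simp add: pos_divide_le_eq)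
    finally have "(G ?c \<bullet> ?c') / u ?c - C \<le> 0" using uc by (simp add: pos_divide_le_eq)
    then show "\<exists>y. (f has_real_derivative y) (at s) \<and> y \<le> 0" using d by blast
  qed
  then have "ln (u y) - ln (u x) \<le> C * \<theta>" using \<theta>(3) by (simp add: f_def)
  also have "\<dots> \<le> C * pi" using C \<theta> by (intro mult_left_mono) auto
  finally have "ln (u y / u x) \<le> C * pi"
    using upos[OF x] upos[OF y] by (simp add: ln_div)
  then have "exp (ln (u y / u x)) \<le> exp (C * pi)" by simp
  then show ?thesis using upos[OF x] upos[OF y] by simp
qed

end

section \<open>The gradient estimate\<close>

lemma Ck_on_cong:
  assumes "open S" "\<And>x. x \<in> S \<Longrightarrow> f x = h x"
  shows "Ck_on k S f \<Longrightarrow> Ck_on k S h"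
proof (cases k)
  case 0
  then show "Ck_on k S f \<Longrightarrow> Ck_on k S h"
    using assms(2) by (simp cong: continuous_on_cong)
next
  case (Suc j)
  have "(h has_derivative D) (at x)" if "(f has_derivative D) (at x)" "x \<in> S" for D x
    using has_derivative_transform_within_open[OF that(1) assms(1) that(2)] assms(2) by auto
  then show "Ck_on k S f \<Longrightarrow> Ck_on k S h"
    unfolding Suc Ck_on.simps by blast
qed

lemma gradient_unique:
  fixes f :: "'a::real_inner \<Rightarrow> real"
  assumes "(f has_derivative (\<lambda>h. a \<bullet> h)) (at x)" "(f has_derivative (\<lambda>h. b \<bullet> h)) (at x)"
  shows "a = b"
  using has_derivative_unique[OF assms] by (metis vector_eq_rdot)

text \<open>\<open>Ck_on\<close> hides its gradient behind an existential quantifier; uniqueness of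
  gradients passes the regularity on to the given \<open>g\<close>.\<close>

lemma Ck_on_Suc_gradient:
  assumes S: "open S" and f: "Ck_on (Suc k) S f"
    and g: "\<And>x. x \<in> S \<Longrightarrow> (f has_derivative (\<lambda>h. g x \<bullet> h)) (at x)"
  shows "Ck_on k S (\<lambda>x. g x $ i)"
proof -
  obtain g' where g': "\<And>x. x \<in> S \<Longrightarrow> (f has_derivative (\<lambda>h. g' x \<bullet> h)) (at x)"
    "\<And>i. Ck_on k S (\<lambda>x. g' x $ i)"
    using f by auto
  have "g' x = g x" if "x \<in> S" for x
    using gradient_unique[OF g'(1)[OF that] g[OF that]] .
  then show ?thesis
    using Ck_on_cong[OF S _ g'(2)[of i], of "\<lambda>x. g x $ i"] by simp
qed

text \<open>Removing two of the three derivatives leaves the entries of \<open>H\<close> of class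
  C^1.\<close>

lemma Hessian_differentiable:
  fixes u :: "real^'m \<Rightarrow> real"
  assumes S: "open S" and u: "Ck_on 3 S u"
    and g: "\<And>x. x \<in> S \<Longrightarrow> (u has_derivative (\<lambda>h. g x \<bullet> h)) (at x)"
    and H: "\<And>x. x \<in> S \<Longrightarrow> (g has_derivative (\<lambda>h. H x *v h)) (at x)"
    and x: "x \<in> S"
  shows "H differentiable (at x)"
proof -
  have "Ck_on (Suc (Suc (Suc 0))) S u" using u by (simp add: numeral_3_eq_3)
  from Ck_on_Suc_gradient[OF S this g]
  have gi: "Ck_on (Suc (Suc 0)) S (\<lambda>x. g x $ i)" for i .
  have "((\<lambda>y. g y $ i) has_derivative (\<lambda>h. H y $ i \<bullet> h)) (at y)" if "y \<in> S" for y i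
    using bounded_linear.has_derivative[OF bounded_linear_vec_nth H[OF that]]
    by (simp add: matrix_vector_mul_component)
  from Ck_on_Suc_gradient[OF S gi this]
  have Hij: "Ck_on (Suc 0) S (\<lambda>x. H x $ i $ j)" for i j .
  have "(\<lambda>y. H y $ i $ j) differentiable (at x)" for i j
    using Hij[of i j] x unfolding Ck_on.simps differentiable_def by blast
  then show ?thesis
    unfolding differentiable_componentwise_within[of H]
    by (auto simp: Basis_vec_def inner_axis)
qed

lemma sphere_nonempty: "sphere (0 :: real^'m) 1 \<noteq> {}"
  by (metis mem_sphere_0 empty_iff norm_axis_1)

text \<open>A real supremum is an upper bound only for a set bounded above; continuity on the
  compact sphere provides this for both parts of the norm.\<close>

lemma C1norm_sphere_bounds:
  fixes \<phi> :: "real^'m \<Rightarrow> real"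
  assumes T: "open T" "sphere 0 1 \<subseteq> T" and \<phi>: "Ck_on 1 T \<phi>"
    and g: "\<And>x. x \<in> T \<Longrightarrow> (\<phi> has_derivative (\<lambda>h. g x \<bullet> h)) (at x)"
    and x: "norm x = 1"
  shows "\<phi> x \<le> C1norm_sphere \<phi> g" and "norm (sgrad g x) \<le> C1norm_sphere \<phi> g"
proof -
  have "Ck_on (Suc 0) T \<phi>" using \<phi> by simp
  from Ck_on_Suc_gradient[OF T(1) this g] have "continuous_on T (\<lambda>x. g x $ i)" for i by simp
  then have "continuous_on T (\<lambda>x. \<chi> i. g x $ i)" by (intro continuous_on_vec_lambda)
  then have gc: "continuous_on (sphere 0 1) g"
    using T(2) by (simp add: continuous_on_subset)
  have \<phi>c: "continuous_on (sphere 0 1) \<phi>"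
    using T(2) by (intro continuous_at_imp_continuous_on ballI has_derivative_continuous[OF g]) auto
  have bdd: "bdd_above (f ` sphere 0 1)" if "continuous_on (sphere 0 1) f" for f :: "real^'m \<Rightarrow> real"
    using that by (intro bounded_imp_bdd_above compact_imp_bounded compact_continuous_image compact_sphere)
  have "continuous_on (sphere 0 1) (\<lambda>x. \<bar>\<phi> x\<bar>)"
    by (intro continuous_intros \<phi>c)
  note bdd1 = bdd[OF this]
  have "continuous_on (sphere 0 1) (\<lambda>x. norm (sgrad g x))"
    unfolding sgrad_def by (intro continuous_intros gc)
  note bdd2 = bdd[OF this]
  have xs: "x \<in> sphere 0 1" using x by simp
  have "\<bar>\<phi> x\<bar> \<le> (SUP x\<in>sphere 0 1. \<bar>\<phi> x\<bar>)" "norm (sgrad g x) \<le> (SUP x\<in>sphere 0 1. norm (sgrad g x))"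
    using cSUP_upper[OF xs bdd1] cSUP_upper[OF xs bdd2] by auto
  then show "\<phi> x \<le> C1norm_sphere \<phi> g" "norm (sgrad g x) \<le> C1norm_sphere \<phi> g"
    using norm_ge_zero[of "sgrad g x"] unfolding C1norm_sphere_def by linarith+
qed

lemma INF_sphere_pos:
  fixes \<phi> :: "real^'m \<Rightarrow> real"
  assumes c: "continuous_on (sphere 0 1) \<phi>" and pos: "\<And>x. norm x = 1 \<Longrightarrow> \<phi> x > 0"
  shows "0 < (INF x\<in>sphere 0 1. \<phi> x)" and "\<And>x. norm x = 1 \<Longrightarrow> (INF x\<in>sphere 0 1. \<phi> x) \<le> \<phi> x"
proof -
  obtain z where z: "z \<in> sphere 0 1" "\<And>y. y \<in> sphere 0 1 \<Longrightarrow> \<phi> z \<le> \<phi> y"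
    using continuous_attains_inf[OF compact_sphere sphere_nonempty c] by blast
  have "\<phi> z \<le> (INF x\<in>sphere 0 1. \<phi> x)"
    by (rule cINF_greatest[OF sphere_nonempty z(2)])
  then show "0 < (INF x\<in>sphere 0 1. \<phi> x)" using pos[of z] z(1) by simp
  have "bdd_below (\<phi> ` sphere 0 1)" using z(2) by (intro bdd_belowI2[of _ "\<phi> z"])
  then show "(INF x\<in>sphere 0 1. \<phi> x) \<le> \<phi> x" if "norm x = 1" for x
    using that by (intro cINF_lower) auto
qed

lemma SUP_div_INF_le:
  fixes u :: "real^'m \<Rightarrow> real"
  assumes c: "continuous_on (sphere 0 1) u" and pos: "\<And>x. norm x = 1 \<Longrightarrow> u x > 0"
    and le: "\<And>x y. norm x = 1 \<Longrightarrow> norm y = 1 \<Longrightarrow> u y / u x \<le> B"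
  shows "(SUP x\<in>sphere 0 1. u x) / (INF x\<in>sphere 0 1. u x) \<le> B"
proof -
  obtain z where z: "z \<in> sphere 0 1" "\<And>y. y \<in> sphere 0 1 \<Longrightarrow> u z \<le> u y"
    using continuous_attains_inf[OF compact_sphere sphere_nonempty c] by blast
  have zp: "u z > 0" using z(1) pos by simp
  have "(SUP x\<in>sphere 0 1. u x) \<le> B * u z"
  proof (rule cSUP_least[OF sphere_nonempty])
    fix y :: "real^'m" assume "y \<in> sphere 0 1"
    then show "u y \<le> B * u z" using le[of z y] z(1) zp by (simp add: pos_divide_le_eq)
  qed
  also have "\<dots> \<le> B * (INF x\<in>sphere 0 1. u x)"
  proof (rule mult_left_mono)
    show "u z \<le> (INF x\<in>sphere 0 1. u x)" by (rule cINF_greatest[OF sphere_nonempty z(2)])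
    show "0 \<le> B" using le[of z z] z(1) zp by simp
  qed
  finally show ?thesis
    using INF_sphere_pos(1)[OF c pos] by (simp add: pos_divide_le_eq)
qed

theorem mainTheorem6:
  fixes k :: nat and m K :: real
  assumes "CARD('m::finite) \<ge> 2" and "1 \<le> k" and "k \<le> CARD('m) - 1"
  shows "\<exists>C>0. \<forall>(p::real) (\<epsilon>::real) (\<phi>::real^'m \<Rightarrow> real) g\<phi> T (u::real^'m \<Rightarrow> real) g H S.
    p > 1 \<and> \<epsilon> > 0 \<and>
    open T \<and> sphere 0 1 \<subseteq> T \<and> smooth_on T \<phi> \<and>
    (\<forall>x\<in>T. (\<phi> has_derivative (\<lambda>h. g\<phi> x \<bullet> h)) (at x)) \<and>
    (\<forall>x\<in>sphere 0 1. \<phi> x > 0) \<and>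
    (INF x\<in>sphere 0 1. \<phi> x) = m \<and> C1norm_sphere \<phi> g\<phi> = K \<and>
    open S \<and> sphere 0 1 \<subseteq> S \<and> Ck_on 3 S u \<and>
    (\<forall>x\<in>S. (u has_derivative (\<lambda>h. g x \<bullet> h)) (at x)) \<and>
    (\<forall>x\<in>S. (g has_derivative (\<lambda>h. H x *v h)) (at x)) \<and>
    (\<forall>x\<in>sphere 0 1. u x > 0) \<and>
    (\<forall>x\<in>sphere 0 1. eigvals (hess_plus u g H x) \<in> Gamma k) \<and>
    (\<forall>x\<in>sphere 0 1. sigma k (hess_plus u g H x) =
        u x powr (p - 1 + \<epsilon>) * ((u x)\<^sup>2 + (norm (sgrad g x))\<^sup>2) powr ((real k + 1 - p) / 2) * \<phi> x)
    \<longrightarrow> (\<forall>x\<in>sphere 0 1. norm (sgrad g x) / u x \<le> C) \<and>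
        (SUP x\<in>sphere 0 1. u x) / (INF x\<in>sphere 0 1. u x) \<le> C"
proof -
  obtain k' where k': "k = Suc k'" using assms(2) by (cases k) auto
  \<comment> \<open>m and K are arbitrary reals at this point, and m > 0 follows only once a
    function \<phi> with this infimum is given. The maximum with 1 keeps C positive in any case,
    also for m = 0, where the quotients are 0.\<close>
  define C where "C = max 1 ((real (Suc k') + 3 * (K / m)) ^ Suc k' *
    ((2 :: real) ^ CARD('m) * real CARD('m) ^ Suc k' * K / m * 2 ^ Suc k'))"
  have C: "C \<ge> 1" by (simp add: C_def)
  \<comment> \<open>The sum serves both claims: C bounds the gradient quotient, and exp (C pi)
    bounds the oscillation.\<close>
  have main: "(\<forall>x\<in>sphere 0 1. norm (sgrad g x) / u x \<le> C + exp (C * pi)) \<and>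
        (SUP x\<in>sphere 0 1. u x) / (INF x\<in>sphere 0 1. u x) \<le> C + exp (C * pi)"
    if \<phi>0: "smooth_on T \<phi>" and u0: "Ck_on 3 S u" and T: "open T" "sphere 0 1 \<subseteq> T"
      and S: "open S" "sphere 0 1 \<subseteq> S" and p: "p > 1" and \<epsilon>: "\<epsilon> > 0"
      and \<phi>: "\<forall>x\<in>T. (\<phi> has_derivative (\<lambda>h. g\<phi> x \<bullet> h)) (at x)" "\<forall>x\<in>sphere 0 1. \<phi> x > 0"
      and m: "(INF x\<in>sphere 0 1. \<phi> x) = m" and K: "C1norm_sphere \<phi> g\<phi> = K"
      and u: "\<forall>x\<in>S. (u has_derivative (\<lambda>h. g x \<bullet> h)) (at x)"
        "\<forall>x\<in>S. (g has_derivative (\<lambda>h. H x *v h)) (at x)" "\<forall>x\<in>sphere 0 1. u x > 0"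
      and adm: "\<forall>x\<in>sphere 0 1. eigvals (hess_plus u g H x) \<in> Gamma k"
      and equ: "\<forall>x\<in>sphere 0 1. sigma k (hess_plus u g H x) =
        u x powr (p - 1 + \<epsilon>) * ((u x)\<^sup>2 + (norm (sgrad g x))\<^sup>2) powr ((real k + 1 - p) / 2) * \<phi> x"
    for p \<epsilon> :: real and \<phi> u :: "real^'m \<Rightarrow> real" and g\<phi> T g H S
  proof -
    interpret sphere_fun u g H S
      by unfold_locales (use S u Hessian_differentiable[OF S(1) u0 bspec[OF u(1)] bspec[OF u(2)]] in auto)
    have es: "esym j (eigvals (W x)) = pminors j (W x)" if "norm x = 1" "j \<le> CARD('m)" for x j
      by (rule esym_eigvals[OF W_transpose[OF in_S[OF that(1)]] that(2)])
    have \<phi>c: "continuous_on (sphere 0 1) \<phi>"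
      using T(2) by (intro continuous_at_imp_continuous_on ballI has_derivative_continuous[OF bspec[OF \<phi>(1)]]) auto
    have \<phi>1: "Ck_on 1 T \<phi>" using \<phi>0 by (simp add: smooth_on_def)
    have upos: "u y > 0" if "norm y = 1" for y using u(3) that by simp
    have \<phi>pos: "\<phi> y > 0" if "norm y = 1" for y using \<phi>(2) that by simp
    have grad: "norm (sgrad g y) / u y \<le> C" if y: "norm y = 1" for y
      unfolding C_def
    proof (rule gradient_bound[where p = p and \<epsilon> = \<epsilon> and \<phi> = \<phi> and g\<phi> = g\<phi>])
      show "Suc k' \<le> CARD('m) - 1" "2 \<le> CARD('m)" using assms k' by auto
      show "0 < pminors j (W x)" if "norm x = 1" "j \<le> Suc k'" for x j
      \<comment> \<open>\<open>Gamma\<close> speaks of orders from 1 on; order 0 is the empty minor,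
        equal to 1.\<close>
      proof (cases "j = 0")
        case False
        then have "0 < esym j (eigvals (W x))"
          using adm that by (simp add: Gamma_def k')
        then show ?thesis using es[of x j] that assms(3) k' by simp
      qed simp
      show "pminors (Suc k') (W x) = u x powr (p - 1 + \<epsilon>) *
          (norm (G x))\<^sup>2 powr ((real (Suc k') + 1 - p) / 2) * \<phi> x" if "norm x = 1" for x
        using bspec[OF equ, of x] es[OF that, of k] that assms(3) by (simp add: sigma_def k' G_norm)
      show "(\<phi> has_derivative (\<lambda>h. g\<phi> x \<bullet> h)) (at x)" if "norm x = 1" for x
        using \<phi>(1) T(2) that by auto
      show "m > 0" using INF_sphere_pos(1)[OF \<phi>c \<phi>pos] m by simp
      show "m \<le> \<phi> x" if "norm x = 1" for x using INF_sphere_pos(2)[OF \<phi>c \<phi>pos that] m by simp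
      show "\<phi> x \<le> K" "norm (sgrad g\<phi> x) \<le> K" if "norm x = 1" for x
        using C1norm_sphere_bounds[OF T \<phi>1 bspec[OF \<phi>(1)] that] K by auto
    qed (use p \<epsilon> upos y in auto)
    have ratio: "u y / u x \<le> exp (C * pi)" if "norm x = 1" "norm y = 1" for x y
      using harnack[OF assms(1) upos _ grad that] C by simp
    have "(SUP x\<in>sphere 0 1. u x) / (INF x\<in>sphere 0 1. u x) \<le> exp (C * pi)"
      using continuous_on_u upos ratio by (rule SUP_div_INF_le)
    moreover have "norm (sgrad g x) / u x \<le> C + exp (C * pi)" if "x \<in> sphere 0 1" for x
    proof -
      have "norm (sgrad g x) / u x \<le> C" using grad[of x] that by simp
      then show ?thesis using exp_gt_zero[of "C * pi"] by linarith
    qed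
    ultimately show ?thesis using C by simp
  qed
  have "C + exp (C * pi) > 0" using C exp_gt_zero[of "C * pi"] by linarith
  then show ?thesis
    by - (rule exI[of _ "C + exp (C * pi)"], rule conjI, assumption,
        intro allI impI, elim conjE, (rule main; assumption))
qed

end
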